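(* Let $\theta_1,\theta_2>0$ with $\min(\theta_1,\theta_2)\le 1$, and let $\theta:=\theta_1+\theta_2$. For every Lipschitz continuous $u\in\mathrm{Lip}(\Omega)$, if $\mathcal{E}_{1+\theta}^{\theta_1,\theta_2}(u)=0$, then $u\in S(\Omega)$.
   Context: Setting: $n_1,n_2\ge 1$, $n=n_1+n_2$, $\mathbf{R}^n=X_1\oplus X_2$ with $X_1\perp X_2$ and $\dim X_l=n_l$; each $x\in\mathbf{R}^n$ is written $x=x_1+x_2$ with $x_l\in X_l$. For $l=1,2$, $\Omega_l\subset X_l$ is a non-empty bounded connected open subset of $X_l$, and $\Omega:=\Omega_1+\Omega_2\subset\mathbf{R}^n$. $L(U)$ denotes the space of real-valued Lebesgue-measurable functions on $U$. The set $S(\Omega)$ consists of all $u\in L(\Omega)$ such that for $l=1$ or $l=2$ there is $u_l\in L(\Omega_l)$ with $u(x)=u_l(x_l)$ for almost every $x\in\Omega$. Kernel: $\rho\in L^1(\mathbf{R}^n,[0,\infty))$ is a fixed radial function with $\int\rho=1$ and $\operatorname{supp}\rho\subset B_1$; $\rho_\varepsilon(z):=\varepsilon^{-n}\rho(z/\varepsilon)$. Energies: for $\varepsilon>0$, $\Omega_l^\varepsilon:=\bigcap_{z_l\in X_l,\,|z_l|<\varepsilon}(\Omega_l-z_l)$ and $\Omega^\varepsilon:=\Omega_1^\varepsilon+\Omega_2^\varepsilon$. For $p,\theta_1,\theta_2>0$ and $u\in L(\Omega)$, $$\mathcal{E}_{\varepsilon,p}^{\theta_1,\theta_2}(u):=\int_{\mathbf{R}^n}\rho_\varepsilon(z)\int_{\Omega^\varepsilon}\frac{|u(x+z_1)-u(x)|^{\theta_1}\,|u(x+z_2)-u(x)|^{\theta_2}}{|z|^p}\,dx\,dz,\qquad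 \mathcal{E}_p^{\theta_1,\theta_2}(u):=\liminf_{\varepsilon\downarrow 0}\mathcal{E}_{\varepsilon,p}^{\theta_1,\theta_2}(u).$$ *)

theory Defs
  imports "HOL-Analysis.Analysis"
begin

text \<open>For \<open>X \<oplus> Y = UNIV\<close>, \<open>component X Y x\<close> is the \<open>X\<close>-summand of \<open>x\<close>.\<close>

definition component :: "'a::euclidean_space set \<Rightarrow> 'a set \<Rightarrow> 'a \<Rightarrow> 'a" where
  "component X Y x = (THE v. v \<in> X \<and> x - v \<in> Y)"

definition orthonormal_basis :: "'a::euclidean_space set \<Rightarrow> 'a set \<Rightarrow> bool" where
  "orthonormal_basis X B \<longleftrightarrow>
     B \<subseteq> X \<and> pairwise orthogonal B \<and> (\<forall>b\<in>B. norm b = 1) \<and> span B = X"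

text \<open>
  Lebesgue measure of the Euclidean space \<open>X\<close>, for a linear subspace \<open>X\<close>. This is the library's
  construction of \<open>lborel\<close> with an orthonormal basis of \<open>X\<close> in place of \<open>Basis\<close>, then completed;
  by rotation invariance the choice of the basis is immaterial. As a measure on the ambient type it
  is concentrated on \<open>X\<close>, so it has to be restricted to the subset of \<open>X\<close> under consideration.
\<close>

definition subspace_lebesgue :: "'a::euclidean_space set \<Rightarrow> 'a measure" where
  "subspace_lebesgue X =
     (let B = (SOME B. orthonormal_basis X B)
      in completion (distr (\<Pi>\<^sub>M b\<in>B. (lborel :: real measure)) borel (\<lambda>c. \<Sum>b\<in>B. c b *\<^sub>R b)))"

definition measurable_fun_on :: "'a::euclidean_space set \<Rightarrow> 'a set \<Rightarrow> ('a \<Rightarrow> real) set" where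
  "measurable_fun_on X U = borel_measurable (restrict_space (subspace_lebesgue X) U)"

definition S_class ::
    "'a::euclidean_space set \<Rightarrow> 'a set \<Rightarrow> 'a set \<Rightarrow> 'a set \<Rightarrow> ('a \<Rightarrow> real) set" where
  "S_class X1 X2 \<Omega>1 \<Omega>2 =
     {u \<in> borel_measurable (lebesgue_on (\<Omega>1 + \<Omega>2)).
        (\<exists>u1 \<in> measurable_fun_on X1 \<Omega>1.
            AE x in lebesgue_on (\<Omega>1 + \<Omega>2). u x = u1 (component X1 X2 x)) \<or>
        (\<exists>u2 \<in> measurable_fun_on X2 \<Omega>2.
            AE x in lebesgue_on (\<Omega>1 + \<Omega>2). u x = u2 (component X2 X1 x))}"

definition rescaled :: "('a::euclidean_space \<Rightarrow> real) \<Rightarrow> real \<Rightarrow> 'a \<Rightarrow> real" where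
  "rescaled \<rho> \<epsilon> z = \<rho> (z /\<^sub>R \<epsilon>) / \<epsilon> ^ DIM('a)"

definition shrink :: "'a::euclidean_space set \<Rightarrow> real \<Rightarrow> 'a set \<Rightarrow> 'a set" where
  "shrink X \<epsilon> U = (\<Inter>z \<in> {z \<in> X. norm z < \<epsilon>}. (\<lambda>x. x - z) ` U)"

text \<open>
  When \<open>\<rho>\<close> is supported in the open unit ball and \<open>u\<close> is given on \<open>\<Omega>1 + \<Omega>2\<close>, values of \<open>u\<close>
  outside \<open>\<Omega>1 + \<Omega>2\<close> play no role below: if \<open>rescaled \<rho> \<epsilon> z \<noteq> 0\<close> then \<open>norm z < \<epsilon>\<close>, and the points
  \<open>x + z\<^sub>l\<close> lie in \<open>\<Omega>1 + \<Omega>2\<close>. The Lebesgue-null point \<open>z = 0\<close>, where the quotient is \<open>0 / 0 = 0\<close>,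
  is irrelevant.
\<close>

definition energy_eps ::
    "'a::euclidean_space set \<Rightarrow> 'a set \<Rightarrow> 'a set \<Rightarrow> 'a set \<Rightarrow> ('a \<Rightarrow> real) \<Rightarrow>
     real \<Rightarrow> real \<Rightarrow> real \<Rightarrow> real \<Rightarrow> ('a \<Rightarrow> real) \<Rightarrow> ennreal" where
  "energy_eps X1 X2 \<Omega>1 \<Omega>2 \<rho> p \<theta>1 \<theta>2 \<epsilon> u =
     (\<integral>\<^sup>+z. ennreal (rescaled \<rho> \<epsilon> z) *
        (\<integral>\<^sup>+x \<in> shrink X1 \<epsilon> \<Omega>1 + shrink X2 \<epsilon> \<Omega>2.
            ennreal (\<bar>u (x + component X1 X2 z) - u x\<bar> powr \<theta>1 *
                     \<bar>u (x + component X2 X1 z) - u x\<bar> powr \<theta>2 / norm z powr p) \<partial>lebesgue)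
      \<partial>lebesgue)"

definition energy ::
    "'a::euclidean_space set \<Rightarrow> 'a set \<Rightarrow> 'a set \<Rightarrow> 'a set \<Rightarrow> ('a \<Rightarrow> real) \<Rightarrow>
     real \<Rightarrow> real \<Rightarrow> real \<Rightarrow> ('a \<Rightarrow> real) \<Rightarrow> ennreal" where
  "energy X1 X2 \<Omega>1 \<Omega>2 \<rho> p \<theta>1 \<theta>2 u =
     Liminf (at_right 0) (\<lambda>\<epsilon>. energy_eps X1 X2 \<Omega>1 \<Omega>2 \<rho> p \<theta>1 \<theta>2 \<epsilon> u)"

end

theory Submission
  imports Defs
begin

text \<open>
  Write \<open>\<delta>\<^sub>a\<close> for the difference quotient of \<open>u\<close> with step \<open>\<epsilon> a\<close>. The roles of the two
  subspaces are symmetric, so assume \<open>\<theta>2 \<le> 1\<close>, and extend \<open>u\<close> to a Lipschitz function on the whole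
  space. Choosing \<open>\<epsilon>\<^sub>k \<down> 0\<close> such that the energies at scale \<open>\<epsilon>\<^sub>k\<close> are summable and substituting
  \<open>z = \<epsilon>\<^sub>k y\<close> gives, for almost every \<open>y = a + b\<close> with \<open>\<rho> y > 0\<close> (\<open>a \<in> X1\<close>, \<open>b \<in> X2\<close>),
  that the integral of \<open>|\<delta>\<^sub>a| powr \<theta>1 * |\<delta>\<^sub>b| powr \<theta>2\<close> is \<open>o(\<epsilon>\<^sub>k)\<close>; as \<open>\<delta>\<^sub>b\<close> is bounded and
  \<open>\<theta>2 \<le> 1\<close>, the same holds with \<open>|\<delta>\<^sub>b|\<close> in place of \<open>|\<delta>\<^sub>b| powr \<theta>2\<close>. Since \<open>\<rho>\<close> is radial, this is
  also true for \<open>\<plusminus>a \<plusminus> b\<close>, which covers the four corners of the parallelogram spanned by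
  \<open>\<epsilon> a\<close> and \<open>\<epsilon> b\<close>.

  The key point is the identity \<open>\<delta>\<^sub>a (x + \<epsilon> b) - \<delta>\<^sub>a x = \<delta>\<^sub>b (x + \<epsilon> a) - \<delta>\<^sub>b x\<close>. With
  \<open>q = \<theta>1 + 1\<close> it bounds the variation of \<open>|\<delta>\<^sub>a| powr q\<close> along a step \<open>\<epsilon> b\<close> by a constant times
  \<open>|\<delta>\<^sub>a| powr \<theta>1 * |\<delta>\<^sub>b|\<close>, summed over the four corners, so that this variation is \<open>o(\<epsilon>\<^sub>k)\<close> in
  \<open>L\<^sup>1\<close>. Adding up the steps along a segment of fixed length (there are \<open>O(1/\<epsilon>\<^sub>k)\<close> of them) yields two
  facts (lemma \<open>propagation\<close>): local constancy of \<open>u\<close> in direction \<open>a\<close> propagates along \<open>b\<close>, and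
  where \<open>u\<close> is not locally constant in direction \<open>a\<close>, it does not change along \<open>b\<close>. In other
  words, the function with value \<open>None\<close> where \<open>u\<close> is locally constant in direction \<open>a\<close> and
  \<open>Some (u x)\<close> elsewhere is locally constant in direction \<open>b\<close>.

  By Fubini's theorem there is a set of directions \<open>a\<close> spanning \<open>X1\<close> such that, for each of them,
  the admissible \<open>b\<close> span \<open>X2\<close> (lemma \<open>spanning_directions\<close>). A connectedness argument then shows
  that \<open>u\<close> is constant along \<open>\<Omega>1\<close> or along \<open>\<Omega>2\<close> (lemma \<open>one_sided_dependence\<close>): if local
  constancy in some direction of \<open>X1\<close> fails somewhere on \<open>{w} + \<Omega>2\<close>, then \<open>u (w + y)\<close> does not
  depend on \<open>y \<in> \<Omega>2\<close>; and a level set, at a nonzero value, of the difference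
  \<open>u (x + y) - u (x + y')\<close> as a function of \<open>x \<in> \<Omega>1\<close> is open and closed and avoids all such \<open>w\<close>.
\<close>

section \<open>Difference quotients and directional local constancy\<close>

text \<open>\<open>f\<close> is constant along short segments in direction \<open>v\<close>, uniformly near \<open>x\<close>. The codomain is
  arbitrary.\<close>

definition loc_const_dir :: "('a::real_normed_vector \<Rightarrow> 'b) \<Rightarrow> 'a \<Rightarrow> 'a \<Rightarrow> bool" where
  "loc_const_dir f v x \<longleftrightarrow> (\<exists>r>0. \<forall>y\<in>ball x r. \<forall>t. \<bar>t\<bar> < r \<longrightarrow> f (y + t *\<^sub>R v) = f y)"

text \<open>Difference quotient of \<open>u\<close> at \<open>x\<close> in direction \<open>a\<close> with step \<open>h\<close>.\<close>

definition diffq :: "('a::real_normed_vector \<Rightarrow> real) \<Rightarrow> real \<Rightarrow> 'a \<Rightarrow> 'a \<Rightarrow> real" where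
  "diffq u h a x = (u (x + h *\<^sub>R a) - u x) / h"

text \<open>The points whose open \<open>r\<close>-ball lies in \<open>\<Omega>\<close>; this set is closed for every \<open>\<Omega>\<close>.\<close>

definition core :: "'a::metric_space set \<Rightarrow> real \<Rightarrow> 'a set" where
  "core \<Omega> r = {x. ball x r \<subseteq> \<Omega>}"

lemma closed_core: "closed (core \<Omega> r)"
proof -
  have "core \<Omega> r = (\<Inter>w\<in>-\<Omega>. {x. r \<le> dist x w})"
    unfolding core_def by (force simp: subset_iff not_less)
  moreover have "closed {x. r \<le> dist x w}" for w :: 'a
    by (intro closed_Collect_le continuous_intros)
  ultimately show ?thesis by auto
qed

lemma core_borel [measurable]: "core \<Omega> r \<in> sets borel"
  by (intro borel_closed closed_core)

lemma core_mono: "r \<le> s \<Longrightarrow> core \<Omega> s \<subseteq> core \<Omega> r"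
  unfolding core_def by (auto intro: less_le_trans)

lemma core_shift:
  fixes x :: "'a::real_normed_vector"
  assumes "x \<in> core \<Omega> r" "norm c + s \<le> r"
  shows "x + c \<in> core \<Omega> s"
proof -
  have "ball (x + c) s \<subseteq> ball x r"
  proof
    fix y assume "y \<in> ball (x + c) s"
    moreover have "dist x y \<le> dist x (x + c) + dist (x + c) y" by (rule dist_triangle)
    ultimately show "y \<in> ball x r" using assms(2) by (simp add: dist_norm)
  qed
  with assms(1) show ?thesis unfolding core_def by auto
qed

lemma nn_integral_lborel_translate:
  fixes f :: "'a::euclidean_space \<Rightarrow> ennreal"
  assumes "f \<in> borel_measurable borel"
  shows "(\<integral>\<^sup>+x. f (x + c) \<partial>lborel) = (\<integral>\<^sup>+x. f x \<partial>lborel)"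
proof -
  have "(\<integral>\<^sup>+x. f x \<partial>lborel) = (\<integral>\<^sup>+x. f x \<partial>distr lborel borel ((+) c))"
    by (simp add: lborel_distr_plus)
  also have "\<dots> = (\<integral>\<^sup>+x. f (x + c) \<partial>lborel)"
    using assms by (subst nn_integral_distr) (auto simp: add.commute)
  finally show ?thesis by simp
qed

lemma powr_diff_le:
  fixes s t q :: real
  assumes "0 \<le> s" "0 \<le> t" "0 < q"
  shows "\<bar>s powr (q + 1) - t powr (q + 1)\<bar> \<le> (q + 1) * (s powr q + t powr q) * \<bar>s - t\<bar>"
proof -
  have *: "t powr (q + 1) - s powr (q + 1) \<le> (q + 1) * (s powr q + t powr q) * (t - s)"
    if "0 \<le> s" "s < t" for s t :: real
  proof (cases "s = 0")
    case True
    then show ?thesis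
      using that assms by (auto simp: powr_add)
  next
    case False
    with that have "0 < s" by simp
    have "\<exists>z>s. z < t \<and> t powr (q + 1) - s powr (q + 1) = (t - s) * ((q + 1) * z powr (q + 1 - 1))"
      using that \<open>0 < s\<close> by (intro MVT2) (auto intro!: derivative_eq_intros)
    then obtain z where z: "s < z" "z < t"
      and eq: "t powr (q + 1) - s powr (q + 1) = (t - s) * ((q + 1) * z powr q)" by auto
    have "z powr q \<le> s powr q + t powr q"
      using powr_mono2[of q z t] z \<open>0 < s\<close> assms by (simp add: add_increasing)
    then have "(t - s) * ((q + 1) * z powr q) \<le> (t - s) * ((q + 1) * (s powr q + t powr q))"
      using that assms by (intro mult_left_mono) auto
    with eq show ?thesis by (simp add: mult_ac)
  qed
  have mono: "x powr (q + 1) \<le> y powr (q + 1)" if "0 \<le> x" "x \<le> y" for x y :: real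
    using that assms by (intro powr_mono2) auto
  consider "s < t" | "s = t" | "t < s" by linarith
  then show ?thesis
  proof cases
    case 1
    then show ?thesis using *[of s t] mono[of s t] assms by simp
  next
    case 3
    then show ?thesis using *[of t s] mono[of t s] assms by (simp add: add.commute)
  qed simp
qed

lemma ennreal_tendsto_0_le:
  fixes f g :: "'b \<Rightarrow> ennreal"
  assumes "\<forall>\<^sub>F k in F. f k \<le> g k" and "(g \<longlongrightarrow> 0) F"
  shows "(f \<longlongrightarrow> 0) F"
  using assms by (intro tendsto_sandwich[where f="\<lambda>_. 0" and g=f and h=g]) auto

locale diffq_setting =
  fixes u :: "'a::euclidean_space \<Rightarrow> real" and L :: real and \<Omega> :: "'a set"
    and \<epsilon> :: "nat \<Rightarrow> real" and \<theta> :: real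
  assumes lip: "L-lipschitz_on UNIV u"
    and \<epsilon>_pos: "\<And>k. 0 < \<epsilon> k" and \<epsilon>_lim: "\<epsilon> \<longlonglongrightarrow> 0" and \<theta>_pos: "0 < \<theta>"
begin

text \<open>The second difference quotient enters with exponent \<open>1\<close>. The factor \<open>1 / \<epsilon> k\<close> is the scaling
  of the critical energy, so that vanishing energy means that this quantity tends to \<open>0\<close>.\<close>

definition interaction :: "'a \<Rightarrow> 'a \<Rightarrow> nat \<Rightarrow> ennreal" where
  "interaction a b k = (\<integral>\<^sup>+x\<in>core \<Omega> (2 * \<epsilon> k).
      ennreal (\<bar>diffq u (\<epsilon> k) a x\<bar> powr \<theta> * \<bar>diffq u (\<epsilon> k) b x\<bar> / \<epsilon> k) \<partial>lborel)"

lemma continuous_u: "continuous_on A u"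
  using lip lipschitz_on_continuous_on lipschitz_on_subset by blast

lemma u_borel [measurable]: "u \<in> borel_measurable borel"
  by (intro borel_measurable_continuous_onI continuous_u)

lemma diffq_borel [measurable]: "diffq u h a \<in> borel_measurable borel"
  unfolding diffq_def[abs_def] by measurable

lemma lip_bound: "\<bar>u x - u y\<bar> \<le> L * norm (x - y)"
  using lipschitz_onD[OF lip, of x y] by (simp add: dist_norm)

lemma L_nonneg: "0 \<le> L"
  using lip by (rule lipschitz_on_nonneg)

lemma diffq_bound:
  assumes "0 < h" "norm a \<le> 1"
  shows "\<bar>diffq u h a x\<bar> \<le> L"
proof -
  have "\<bar>u (x + h *\<^sub>R a) - u x\<bar> \<le> L * (h * norm a)"
    using lip_bound[of "x + h *\<^sub>R a" x] assms by simp
  also have "\<dots> \<le> L * (h * 1)"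
    using assms L_nonneg by (intro mult_left_mono) auto
  finally show ?thesis
    using assms by (simp add: diffq_def abs_divide pos_divide_le_eq)
qed

lemma eventually_\<epsilon>_less: "0 < r \<Longrightarrow> \<forall>\<^sub>F k in sequentially. \<epsilon> k < r"
  using order_tendstoD(2)[OF \<epsilon>_lim] by simp

text \<open>Number of full steps of length \<open>\<epsilon> k\<close> that fit into a length \<open>s\<close>.\<close>

definition steps :: "real \<Rightarrow> nat \<Rightarrow> nat" where
  "steps s k = nat \<lfloor>s / \<epsilon> k\<rfloor>"

lemma steps_le: "0 \<le> s \<Longrightarrow> real (steps s k) * \<epsilon> k \<le> s"
  and steps_gt: "0 \<le> s \<Longrightarrow> s - \<epsilon> k < real (steps s k) * \<epsilon> k"
proof -
  assume s: "0 \<le> s"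
  have n: "real (steps s k) = of_int \<lfloor>s / \<epsilon> k\<rfloor>"
    using s \<epsilon>_pos[of k] by (simp add: steps_def)
  have "of_int \<lfloor>s / \<epsilon> k\<rfloor> \<le> s / \<epsilon> k" "s / \<epsilon> k < of_int \<lfloor>s / \<epsilon> k\<rfloor> + 1"
    by linarith+
  from mult_right_mono[OF this(1), of "\<epsilon> k"] mult_strict_right_mono[OF this(2), of "\<epsilon> k"] \<epsilon>_pos[of k]
  show "real (steps s k) * \<epsilon> k \<le> s" "s - \<epsilon> k < real (steps s k) * \<epsilon> k"
    unfolding n by (auto simp add: distrib_right)
qed

lemma telescope:
  "\<bar>u (x + (real j * \<epsilon> k) *\<^sub>R v) - u x\<bar>
     \<le> \<epsilon> k * (\<Sum>i<j. \<bar>diffq u (\<epsilon> k) v (x + (real i * \<epsilon> k) *\<^sub>R v)\<bar>)"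
proof (induction j)
  case (Suc j)
  have "u (x + (real j * \<epsilon> k) *\<^sub>R v + \<epsilon> k *\<^sub>R v) = u (x + (real (Suc j) * \<epsilon> k) *\<^sub>R v)"
    by (simp add: scaleR_left_distrib distrib_right add.commute add.left_commute)
  then have "\<epsilon> k * \<bar>diffq u (\<epsilon> k) v (x + (real j * \<epsilon> k) *\<^sub>R v)\<bar>
      = \<bar>u (x + (real (Suc j) * \<epsilon> k) *\<^sub>R v) - u (x + (real j * \<epsilon> k) *\<^sub>R v)\<bar>"
    using \<epsilon>_pos[of k] unfolding diffq_def abs_divide by (simp del: of_nat_Suc)
  with Suc show ?case by (simp add: distrib_left)
qed simp

text \<open>The \<open>(\<theta> + 1)\<close>-th moments of the difference quotients in direction \<open>a\<close> vanish in the limit on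
  some ball around \<open>x\<close>. This integral condition is equivalent to local constancy in direction \<open>a\<close>.\<close>

definition flat :: "'a \<Rightarrow> 'a \<Rightarrow> bool" where
  "flat a x \<longleftrightarrow> (\<exists>r>0. (\<lambda>k. \<integral>\<^sup>+y\<in>ball x r. ennreal (\<bar>diffq u (\<epsilon> k) a y\<bar> powr (\<theta> + 1)) \<partial>lborel)
      \<longlonglongrightarrow> 0)"

lemma loc_const_dir_imp_flat:
  assumes "loc_const_dir u a x"
  shows "flat a x"
proof -
  from assms obtain r where r: "r > 0" "\<And>y t. y \<in> ball x r \<Longrightarrow> \<bar>t\<bar> < r \<Longrightarrow> u (y + t *\<^sub>R a) = u y"
    unfolding loc_const_dir_def by auto
  have "\<forall>\<^sub>F k in sequentially.
      (\<integral>\<^sup>+y\<in>ball x r. ennreal (\<bar>diffq u (\<epsilon> k) a y\<bar> powr (\<theta> + 1)) \<partial>lborel) = 0"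
    using eventually_\<epsilon>_less[OF r(1)]
  proof eventually_elim
    case (elim k)
    have "ennreal (\<bar>diffq u (\<epsilon> k) a y\<bar> powr (\<theta> + 1)) * indicator (ball x r) y = 0" for y
      using r(2)[of y "\<epsilon> k"] \<epsilon>_pos[of k] elim by (auto simp: indicator_def diffq_def)
    then show ?case by (simp only: nn_integral_const mult_zero_left)
  qed
  from tendsto_eventually[OF this] r(1) show ?thesis
    unfolding flat_def by (intro exI[of _ r] conjI)
qed

lemma flat_imp_loc_const_dir:
  assumes "flat a x"
  shows "loc_const_dir u a x"
proof -
  from assms obtain r where r: "r > 0" and
    lim: "(\<lambda>k. \<integral>\<^sup>+y\<in>ball x r. ennreal (\<bar>diffq u (\<epsilon> k) a y\<bar> powr (\<theta> + 1)) \<partial>lborel) \<longlonglongrightarrow> 0"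
    unfolding flat_def by auto
  \<comment> \<open>If \<open>u\<close> changed by \<open>c\<close> between \<open>y\<close> and \<open>y + t a\<close>, it would change by at least \<open>c / 2\<close> in about
    \<open>t / \<epsilon> k\<close> steps from every point of a small ball around \<open>y\<close>. The sum of the difference
    quotients over these steps is small, by Young's inequality and translation invariance.\<close>
  have forward: "u (y + t *\<^sub>R a) = u y" if y: "dist x y < r / 2" and t: "0 \<le> t" "t * norm a < r / 2" for y t
  proof (rule ccontr)
    assume ne: "u (y + t *\<^sub>R a) \<noteq> u y"
    define c where "c = \<bar>u (y + t *\<^sub>R a) - u y\<bar>"
    have c: "c > 0" using ne by (simp add: c_def)
    define M where "M = L * (2 + norm a) + 1"
    have M: "M > 0" unfolding M_def using L_nonneg by (intro add_nonneg_pos mult_nonneg_nonneg) auto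
    define s where "s = min (c / (2 * M)) (r / 2 - dist x y)"
    have s: "s > 0" using c M y by (simp add: s_def)
    have sM: "s * M \<le> c / 2"
    proof -
      have "s \<le> c / (2 * M)" by (simp add: s_def)
      then show ?thesis using M by (simp add: field_simps)
    qed
    define \<eta> where "\<eta> = c / (4 * (t + 1))"
    have \<eta>: "\<eta> > 0" using c t by (simp add: \<eta>_def)
    have t\<eta>: "t * \<eta> \<le> c / 4"
      using c t by (simp add: \<eta>_def field_simps)
    define C where "C = \<eta> powr (- \<theta>)"
    have C: "C > 0" using \<eta> by (simp add: C_def)
    have young: "d \<le> \<eta> + C * d powr (\<theta> + 1)" if "d \<ge> 0" for d
    proof (cases "d \<le> \<eta>")
      case True
      have "C * d powr (\<theta> + 1) \<ge> 0" using C by simp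
      with True show ?thesis by linarith
    next
      case False
      with \<eta> have d: "0 < d" by simp
      have "1 = \<eta> powr (-\<theta>) * \<eta> powr \<theta>" using \<eta> by (simp add: powr_minus)
      also have "\<dots> \<le> C * d powr \<theta>"
        unfolding C_def using False \<eta> \<theta>_pos by (intro mult_left_mono powr_mono2) auto
      finally have "1 * d \<le> C * d powr \<theta> * d" using d by (intro mult_right_mono) auto
      also have "\<dots> = C * d powr (\<theta> + 1)" using d by (simp add: powr_add)
      finally show ?thesis using \<eta> by simp
    qed
    let ?G = "\<lambda>k z. \<bar>diffq u (\<epsilon> k) a z\<bar> powr (\<theta> + 1)"
    let ?I = "\<lambda>k. \<integral>\<^sup>+z\<in>ball x r. ennreal (?G k z) \<partial>lborel"
    have "\<forall>\<^sub>F k in sequentially. ennreal (c / 4) * emeasure lborel (ball y s) \<le> ennreal (C * t) * ?I k"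
      using eventually_\<epsilon>_less[OF s]
    proof eventually_elim
      case (elim k)
      define j where "j = steps t k"
      have jt: "real j * \<epsilon> k \<le> t" "t - \<epsilon> k < real j * \<epsilon> k"
        using steps_le steps_gt t by (auto simp: j_def)
      have low: "c / 4 \<le> C * \<epsilon> k * (\<Sum>i<j. ?G k (z + (real i * \<epsilon> k) *\<^sub>R a))" if z: "z \<in> ball y s" for z
      proof -
        have "\<bar>u (y + t *\<^sub>R a) - u (z + (real j * \<epsilon> k) *\<^sub>R a)\<bar>
            \<le> L * norm ((y - z) + (t - real j * \<epsilon> k) *\<^sub>R a)"
          using lip_bound[of "y + t *\<^sub>R a" "z + (real j * \<epsilon> k) *\<^sub>R a"] by (simp add: algebra_simps)
        also have "\<dots> \<le> L * (s + s * norm a)"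
        proof (intro mult_left_mono L_nonneg norm_triangle_le add_mono)
          show "norm (y - z) \<le> s" using z by (simp add: dist_norm)
          show "norm ((t - real j * \<epsilon> k) *\<^sub>R a) \<le> s * norm a"
            using jt elim by (auto intro!: mult_right_mono)
        qed
        finally have 1: "\<bar>u (y + t *\<^sub>R a) - u (z + (real j * \<epsilon> k) *\<^sub>R a)\<bar> \<le> L * (s + s * norm a)" .
        have 2: "\<bar>u y - u z\<bar> \<le> L * s"
          using lip_bound[of y z] z L_nonneg
          by (smt (verit, best) dist_norm mem_ball mult_left_mono)
        have "c \<le> \<bar>u (z + (real j * \<epsilon> k) *\<^sub>R a) - u z\<bar> + L * (s + s * norm a) + L * s"
          using 1 2 unfolding c_def by linarith
        moreover have "L * (s + s * norm a) + L * s \<le> s * M"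
          unfolding M_def using s by (simp add: algebra_simps)
        ultimately have "c / 2 \<le> \<bar>u (z + (real j * \<epsilon> k) *\<^sub>R a) - u z\<bar>"
          using sM by linarith
        also have "\<dots> \<le> \<epsilon> k * (\<Sum>i<j. \<bar>diffq u (\<epsilon> k) a (z + (real i * \<epsilon> k) *\<^sub>R a)\<bar>)"
          by (rule telescope)
        also have "\<dots> \<le> \<epsilon> k * (\<Sum>i<j. \<eta> + C * ?G k (z + (real i * \<epsilon> k) *\<^sub>R a))"
          using \<epsilon>_pos[of k] by (intro mult_left_mono sum_mono young) auto
        also have "\<dots> = (real j * \<epsilon> k) * \<eta> + C * \<epsilon> k * (\<Sum>i<j. ?G k (z + (real i * \<epsilon> k) *\<^sub>R a))"
          by (simp add: sum.distrib distrib_left sum_distrib_left mult_ac)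
        also have "(real j * \<epsilon> k) * \<eta> \<le> c / 4"
          using mult_right_mono[OF jt(1), of \<eta>] \<eta> t\<eta> by linarith
        finally show ?thesis by simp
      qed
      define F where "F = (\<lambda>z. ennreal (?G k z) * indicator (ball x r) z)"
      have F [measurable]: "F \<in> borel_measurable borel"
        unfolding F_def
        by (intro borel_measurable_times_ennreal borel_measurable_indicator borel_open open_ball) measurable
      have Fshift: "(\<lambda>z. F (z + w)) \<in> borel_measurable borel" for w
        by (rule measurable_compose[OF _ F]) measurable
      have "ennreal (c / 4) * emeasure lborel (ball y s) = (\<integral>\<^sup>+z. ennreal (c / 4) * indicator (ball y s) z \<partial>lborel)"
        by (simp add: nn_integral_cmult_indicator)
      also have "\<dots> \<le> (\<integral>\<^sup>+z. (\<Sum>i<j. ennreal (C * \<epsilon> k) * F (z + (real i * \<epsilon> k) *\<^sub>R a)) \<partial>lborel)"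
      proof (intro nn_integral_mono)
        fix z
        show "ennreal (c / 4) * indicator (ball y s) z \<le>
            (\<Sum>i<j. ennreal (C * \<epsilon> k) * F (z + (real i * \<epsilon> k) *\<^sub>R a))"
        proof (cases "z \<in> ball y s")
          case True
          have ind: "z + (real i * \<epsilon> k) *\<^sub>R a \<in> ball x r" if i: "i < j" for i
          proof -
            have "real i * \<epsilon> k \<le> t"
              using mult_right_mono[of "real i" "real j" "\<epsilon> k"] \<epsilon>_pos[of k] i jt(1) by linarith
            then have "norm ((real i * \<epsilon> k) *\<^sub>R a) \<le> t * norm a"
              using \<epsilon>_pos[of k] by (auto intro!: mult_right_mono)
            moreover have "dist x z < r / 2"
              using True dist_triangle[of x z y] unfolding s_def by simp
            moreover have "dist x (z + (real i * \<epsilon> k) *\<^sub>R a) \<le> dist x z + norm ((real i * \<epsilon> k) *\<^sub>R a)"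
              using dist_triangle[of x "z + (real i * \<epsilon> k) *\<^sub>R a" z] by (simp add: dist_norm)
            ultimately show ?thesis using t by simp
          qed
          have "ennreal (c / 4) \<le> ennreal (C * \<epsilon> k * (\<Sum>i<j. ?G k (z + (real i * \<epsilon> k) *\<^sub>R a)))"
            using low[OF True] by (rule ennreal_leI)
          also have "\<dots> = (\<Sum>i<j. ennreal (C * \<epsilon> k) * ennreal (?G k (z + (real i * \<epsilon> k) *\<^sub>R a)))"
            using C \<epsilon>_pos[of k] by (simp add: ennreal_mult sum_nonneg sum_ennreal[symmetric] sum_distrib_left)
          also have "\<dots> = (\<Sum>i<j. ennreal (C * \<epsilon> k) * F (z + (real i * \<epsilon> k) *\<^sub>R a))"
            using ind by (intro sum.cong) (auto simp: indicator_def F_def)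
          finally show ?thesis using True by simp
        qed simp
      qed
      also have "\<dots> = (\<Sum>i<j. ennreal (C * \<epsilon> k) * (\<integral>\<^sup>+z. F (z + (real i * \<epsilon> k) *\<^sub>R a) \<partial>lborel))"
        using Fshift by (simp add: nn_integral_sum nn_integral_cmult)
      also have "\<dots> = (\<Sum>i<j. ennreal (C * \<epsilon> k) * ?I k)"
        by (simp add: nn_integral_lborel_translate[OF F]) (simp add: F_def)
      also have "\<dots> = ennreal (C * (real j * \<epsilon> k)) * ?I k"
        using C \<epsilon>_pos[of k] by (simp add: ennreal_mult ennreal_of_nat_eq_real_of_nat mult_ac)
      also have "\<dots> \<le> ennreal (C * t) * ?I k"
        using C jt by (intro mult_right_mono ennreal_leI) auto
      finally show ?case .
    qed
    moreover have "(\<lambda>k. ennreal (C * t) * ?I k) \<longlonglongrightarrow> ennreal (C * t) * 0"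
      by (intro ennreal_tendsto_cmult lim) auto
    ultimately have "ennreal (c / 4) * emeasure lborel (ball y s) \<le> ennreal (C * t) * 0"
      by (intro tendsto_lowerbound) auto
    then have "emeasure lborel (ball y s) = 0"
      using c by auto
    then have "ball y s \<in> null_sets lborel" by (simp add: null_setsI)
    then have "negligible (ball y s)"
      by (simp add: negligible_iff_null_sets null_sets_completionI)
    then show False using open_not_negligible[of "ball y s"] s by simp
  qed
  have "u (y + t *\<^sub>R a) = u y" if "dist x y < r / 4" "\<bar>t\<bar> * norm a < r / 4" for y t
  proof (cases "t \<ge> 0")
    case True
    then show ?thesis using that r by (intro forward) auto
  next
    case False
    have "dist x (y + t *\<^sub>R a) \<le> dist x y + \<bar>t\<bar> * norm a"
      using dist_triangle[of x "y + t *\<^sub>R a" y] by (simp add: dist_norm)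
    then have "u ((y + t *\<^sub>R a) + (- t) *\<^sub>R a) = u (y + t *\<^sub>R a)"
      using False that r by (intro forward) auto
    then show ?thesis by simp
  qed
  note * = this
  define r' where "r' = r / (4 * (norm a + 1))"
  have "r' > 0" using r unfolding r'_def
    by (intro divide_pos_pos mult_pos_pos) (auto intro: add_nonneg_pos)
  have n: "norm a + 1 > 0" by (rule add_nonneg_pos) auto
  have "r' * (norm a + 1) = r / 4"
    unfolding r'_def using n by (simp del: distrib_left_numeral)
  then have eq: "r' * norm a + r' = r / 4"
    by (simp add: distrib_left)
  have 1: "r' \<le> r / 4" using eq \<open>r' > 0\<close> by (smt (verit) mult_nonneg_nonneg norm_ge_zero)
  have 2: "t * norm a < r / 4" if "0 \<le> t" "t < r'" for t
    using that eq \<open>r' > 0\<close> mult_right_mono[of t r' "norm a"] by auto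
  show ?thesis
    unfolding loc_const_dir_def using \<open>r' > 0\<close> 1 2 * by (intro exI[of _ r']) auto
qed

lemma flat_iff: "flat a x \<longleftrightarrow> loc_const_dir u a x"
  using loc_const_dir_imp_flat flat_imp_loc_const_dir by blast

end

section \<open>Propagation along a pair of directions with vanishing interaction\<close>

locale good_pair = diffq_setting +
  fixes a b :: 'a
  assumes norm_a: "norm a \<le> 1" and norm_b: "norm b \<le> 1"
    and int_pp: "interaction a b \<longlonglongrightarrow> 0" and int_pm: "interaction a (- b) \<longlonglongrightarrow> 0"
    and int_mp: "interaction (- a) b \<longlonglongrightarrow> 0" and int_mm: "interaction (- a) (- b) \<longlonglongrightarrow> 0"
begin

text \<open>The power \<open>\<theta> + 1\<close> is chosen so that the increments of \<open>G\<close> along \<open>b\<close> are controlled by the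
  interaction of \<open>a\<close> and \<open>b\<close>, see \<open>osc_lim\<close>.\<close>

definition G :: "nat \<Rightarrow> 'a \<Rightarrow> real" where
  "G k x = \<bar>diffq u (\<epsilon> k) a x\<bar> powr (\<theta> + 1)"

text \<open>The \<open>L\<^sup>1\<close> norm of the increment of \<open>G\<close> along one step \<open>\<epsilon> k *\<^sub>R b\<close>, relative to \<open>\<epsilon> k\<close>.\<close>

definition osc :: "nat \<Rightarrow> ennreal" where
  "osc k = (\<integral>\<^sup>+x\<in>core \<Omega> (4 * \<epsilon> k). ennreal (\<bar>G k (x + \<epsilon> k *\<^sub>R b) - G k x\<bar> / \<epsilon> k) \<partial>lborel)"

lemma G_borel [measurable]: "G k \<in> borel_measurable borel"
  unfolding G_def[abs_def] by measurable

lemma G_nonneg [simp]: "0 \<le> G k x"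
  by (simp add: G_def)

lemma ball_borel: "ball (x::'a) r \<in> sets borel"
  by (intro borel_open open_ball)

lemma interaction_shift:
  assumes c: "norm c \<le> 2 * \<epsilon> k"
  shows "(\<integral>\<^sup>+x\<in>core \<Omega> (4 * \<epsilon> k). ennreal (\<bar>diffq u (\<epsilon> k) v (x + c)\<bar> powr \<theta> *
            \<bar>diffq u (\<epsilon> k) w (x + c)\<bar> / \<epsilon> k) \<partial>lborel) \<le> interaction v w k"
proof -
  define F where "F = (\<lambda>x. ennreal (\<bar>diffq u (\<epsilon> k) v x\<bar> powr \<theta> *
            \<bar>diffq u (\<epsilon> k) w x\<bar> / \<epsilon> k) * indicator (core \<Omega> (2 * \<epsilon> k)) x)"
  have F: "F \<in> borel_measurable borel"
    unfolding F_def by (intro borel_measurable_times_ennreal borel_measurable_indicator core_borel) measurable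
  have "x + c \<in> core \<Omega> (2 * \<epsilon> k)" if "x \<in> core \<Omega> (4 * \<epsilon> k)" for x
    using that c by (intro core_shift) auto
  then have "(\<integral>\<^sup>+x\<in>core \<Omega> (4 * \<epsilon> k). ennreal (\<bar>diffq u (\<epsilon> k) v (x + c)\<bar> powr \<theta> *
            \<bar>diffq u (\<epsilon> k) w (x + c)\<bar> / \<epsilon> k) \<partial>lborel) \<le> (\<integral>\<^sup>+x. F (x + c) \<partial>lborel)"
    by (intro nn_integral_mono) (auto simp: F_def indicator_def)
  also have "\<dots> = interaction v w k"
    unfolding nn_integral_lborel_translate[OF F] by (simp add: F_def interaction_def)
  finally show ?thesis .
qed

lemma osc_lim: "osc \<longlonglongrightarrow> 0"
proof -
  have bound: "osc k \<le> ennreal (\<theta> + 1) * (interaction a (- b) k + interaction (- a) (- b) k +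
      interaction a b k + interaction (- a) b k)" for k
  proof -
    let ?e = "\<epsilon> k"
    define P where "P = (\<lambda>v w c x. \<bar>diffq u ?e v (x + c)\<bar> powr \<theta> * \<bar>diffq u ?e w (x + c)\<bar> / ?e)"
    have P [measurable]: "(\<lambda>x. ennreal (P v w c x) * indicator (core \<Omega> (4 * ?e)) x) \<in> borel_measurable borel" for v w c
      unfolding P_def by (intro borel_measurable_times_ennreal borel_measurable_indicator core_borel) measurable
    have P0: "0 \<le> P v w c x" for v w c x
      using \<epsilon>_pos[of k] by (simp add: P_def)
    let ?A = "?e *\<^sub>R a" and ?B = "?e *\<^sub>R b"
    have nA: "norm ?A \<le> 2 * ?e" "norm ?B \<le> 2 * ?e" "norm (?A + ?B) \<le> 2 * ?e" "norm (0::'a) \<le> 2 * ?e"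
    proof -
      have A: "norm ?A \<le> ?e" and B: "norm ?B \<le> ?e"
        using \<epsilon>_pos[of k] norm_a norm_b by auto
      have "norm (?A + ?B) \<le> norm ?A + norm ?B" by (rule norm_triangle_ineq)
      with A B \<epsilon>_pos[of k]
      show "norm ?A \<le> 2 * ?e" "norm ?B \<le> 2 * ?e" "norm (?A + ?B) \<le> 2 * ?e" "norm (0::'a) \<le> 2 * ?e"
        by (simp_all del: norm_scaleR)
    qed
    have pt: "\<bar>G k (x + ?B) - G k x\<bar> / ?e \<le>
        (\<theta> + 1) * (P a (-b) ?B x + P (-a) (-b) (?A + ?B) x + P a b 0 x + P (-a) b ?A x)" for x
    proof -
      let ?s = "\<bar>diffq u ?e a (x + ?B)\<bar>" and ?t = "\<bar>diffq u ?e a x\<bar>"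
      let ?p = "\<bar>diffq u ?e b x\<bar>" and ?q = "\<bar>diffq u ?e b (x + ?A)\<bar>"
      \<comment> \<open>The mixed second difference can be read in both directions; each of the four products below
        is an interaction density at one of the corners \<open>x\<close>, \<open>x + ?A\<close>, \<open>x + ?B\<close>, \<open>x + ?A + ?B\<close>.\<close>
      have "diffq u ?e a (x + ?B) - diffq u ?e a x = diffq u ?e b (x + ?A) - diffq u ?e b x"
        by (simp add: diffq_def diff_divide_distrib add_ac)
      then have st: "\<bar>?s - ?t\<bar> \<le> ?p + ?q" by linarith
      have "\<bar>G k (x + ?B) - G k x\<bar> \<le> (\<theta> + 1) * (?s powr \<theta> + ?t powr \<theta>) * \<bar>?s - ?t\<bar>"
        unfolding G_def using \<theta>_pos by (intro powr_diff_le) auto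
      also have "\<dots> \<le> (\<theta> + 1) * (?s powr \<theta> + ?t powr \<theta>) * (?p + ?q)"
        using \<theta>_pos st by (intro mult_left_mono) auto
      finally have "\<bar>G k (x + ?B) - G k x\<bar> / ?e \<le> (\<theta> + 1) * (?s powr \<theta> + ?t powr \<theta>) * (?p + ?q) / ?e"
        using \<epsilon>_pos[of k] by (intro divide_right_mono) auto
      also have "\<dots> = (\<theta> + 1) * (?s powr \<theta> * ?p / ?e + ?s powr \<theta> * ?q / ?e + ?t powr \<theta> * ?p / ?e + ?t powr \<theta> * ?q / ?e)"
        by (simp add: algebra_simps add_divide_distrib)
      also have "?s powr \<theta> * ?p / ?e = P a (-b) ?B x"
        by (simp add: P_def diffq_def abs_minus_commute)
      also have "?s powr \<theta> * ?q / ?e = P (-a) (-b) (?A + ?B) x"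
        by (simp add: P_def diffq_def abs_minus_commute add_ac)
      also have "?t powr \<theta> * ?p / ?e = P a b 0 x"
        by (simp add: P_def)
      also have "?t powr \<theta> * ?q / ?e = P (-a) b ?A x"
        by (simp add: P_def diffq_def abs_minus_commute)
      finally show ?thesis .
    qed
    let ?I = "\<lambda>v w c. \<integral>\<^sup>+x\<in>core \<Omega> (4 * ?e). ennreal (P v w c x) \<partial>lborel"
    have "osc k \<le> (\<integral>\<^sup>+x. ennreal (\<theta> + 1) * (
        ennreal (P a (-b) ?B x) * indicator (core \<Omega> (4 * ?e)) x +
        ennreal (P (-a) (-b) (?A + ?B) x) * indicator (core \<Omega> (4 * ?e)) x +
        ennreal (P a b 0 x) * indicator (core \<Omega> (4 * ?e)) x +
        ennreal (P (-a) b ?A x) * indicator (core \<Omega> (4 * ?e)) x) \<partial>lborel)"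
      unfolding osc_def
    proof (intro nn_integral_mono)
      fix x
      have "ennreal (\<bar>G k (x + ?B) - G k x\<bar> / ?e) \<le> ennreal (\<theta> + 1) * (ennreal (P a (-b) ?B x) +
        ennreal (P (-a) (-b) (?A + ?B) x) + ennreal (P a b 0 x) + ennreal (P (-a) b ?A x))"
        using ennreal_leI[OF pt[of x]] P0 \<theta>_pos by (simp add: ennreal_mult add_nonneg_nonneg)
      then show "ennreal (\<bar>G k (x + ?B) - G k x\<bar> / ?e) * indicator (core \<Omega> (4 * ?e)) x \<le>
         ennreal (\<theta> + 1) * (
        ennreal (P a (-b) ?B x) * indicator (core \<Omega> (4 * ?e)) x +
        ennreal (P (-a) (-b) (?A + ?B) x) * indicator (core \<Omega> (4 * ?e)) x +
        ennreal (P a b 0 x) * indicator (core \<Omega> (4 * ?e)) x +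
        ennreal (P (-a) b ?A x) * indicator (core \<Omega> (4 * ?e)) x)"
        by (auto simp: indicator_def)
    qed
    also have "\<dots> = ennreal (\<theta> + 1) * (?I a (-b) ?B + ?I (-a) (-b) (?A + ?B) + ?I a b 0 + ?I (-a) b ?A)"
      using P by (simp add: nn_integral_cmult nn_integral_add)
    also have "\<dots> \<le> ennreal (\<theta> + 1) * (interaction a (- b) k + interaction (- a) (- b) k +
      interaction a b k + interaction (- a) b k)"
      unfolding P_def by (intro mult_left_mono add_mono interaction_shift nA) auto
    finally show ?thesis .
  qed
  have "(\<lambda>k. ennreal (\<theta> + 1) * (interaction a (- b) k + interaction (- a) (- b) k +
      interaction a b k + interaction (- a) b k)) \<longlonglongrightarrow> ennreal (\<theta> + 1) * (0 + 0 + 0 + 0)"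
    by (intro ennreal_tendsto_cmult tendsto_add int_pp int_pm int_mp int_mm) auto
  then show ?thesis
    using bound by (intro ennreal_tendsto_0_le[where f=osc, OF always_eventually]) auto
qed

lemma G_translate:
  assumes B: "B \<in> sets borel"
    and stay: "\<And>i x. i < j \<Longrightarrow> x \<in> B \<Longrightarrow> x + (real i * \<epsilon> k) *\<^sub>R b \<in> core \<Omega> (4 * \<epsilon> k)"
  shows "(\<integral>\<^sup>+x\<in>B. ennreal \<bar>G k (x + (real j * \<epsilon> k) *\<^sub>R b) - G k x\<bar> \<partial>lborel)
           \<le> ennreal (real j * \<epsilon> k) * osc k"
  using stay
proof (induction j)
  case (Suc j)
  let ?e = "\<epsilon> k"
  let ?c = "(real j * ?e) *\<^sub>R b"
  define F where "F = (\<lambda>x. ennreal \<bar>G k (x + ?e *\<^sub>R b) - G k x\<bar> * indicator (core \<Omega> (4 * ?e)) x)"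
  have F: "F \<in> borel_measurable borel"
    unfolding F_def by (intro borel_measurable_times_ennreal borel_measurable_indicator core_borel) measurable
  have F_int: "(\<integral>\<^sup>+x. F x \<partial>lborel) = ennreal ?e * osc k"
  proof -
    have F_eq: "F = (\<lambda>x. ennreal ?e * (ennreal (\<bar>G k (x + ?e *\<^sub>R b) - G k x\<bar> / ?e) * indicator (core \<Omega> (4 * ?e)) x))"
      using \<epsilon>_pos[of k] by (auto simp: F_def indicator_def ennreal_mult[symmetric])
    have "(\<lambda>x. ennreal (\<bar>G k (x + ?e *\<^sub>R b) - G k x\<bar> / ?e) * indicator (core \<Omega> (4 * ?e)) x)
        \<in> borel_measurable borel"
      by (intro borel_measurable_times_ennreal borel_measurable_indicator core_borel) measurable
    then show ?thesis
      unfolding osc_def F_eq by (simp add: nn_integral_cmult)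
  qed
  have step_eq: "x + (real (Suc j) * ?e) *\<^sub>R b = (x + ?c) + ?e *\<^sub>R b" for x
    by (simp add: scaleR_left_distrib distrib_right add_ac)
  have "(\<integral>\<^sup>+x\<in>B. ennreal \<bar>G k (x + (real (Suc j) * ?e) *\<^sub>R b) - G k x\<bar> \<partial>lborel) \<le>
      (\<integral>\<^sup>+x. F (x + ?c) + ennreal \<bar>G k (x + ?c) - G k x\<bar> * indicator B x \<partial>lborel)"
  proof (intro nn_integral_mono)
    fix x
    show "ennreal \<bar>G k (x + (real (Suc j) * ?e) *\<^sub>R b) - G k x\<bar> * indicator B x
      \<le> F (x + ?c) + ennreal \<bar>G k (x + ?c) - G k x\<bar> * indicator B x"
    proof (cases "x \<in> B")
      case True
      with Suc.prems[of j x] have "x + ?c \<in> core \<Omega> (4 * ?e)" by simp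
      then show ?thesis
        unfolding step_eq F_def using True by (simp add: ennreal_plus[symmetric] del: ennreal_plus)
    qed simp
  qed
  also have "\<dots> = (\<integral>\<^sup>+x. F (x + ?c) \<partial>lborel) + (\<integral>\<^sup>+x\<in>B. ennreal \<bar>G k (x + ?c) - G k x\<bar> \<partial>lborel)"
  proof -
    have "(\<lambda>x. F (x + ?c)) \<in> borel_measurable borel"
      by (rule measurable_compose[OF _ F]) measurable
    moreover have "(\<lambda>x. ennreal \<bar>G k (x + ?c) - G k x\<bar> * indicator B x) \<in> borel_measurable borel"
      by (rule borel_measurable_times_ennreal[OF _ borel_measurable_indicator[OF B]]) measurable
    ultimately show ?thesis by (simp add: nn_integral_add)
  qed
  also have "\<dots> \<le> ennreal ?e * osc k + ennreal (real j * ?e) * osc k"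
    unfolding nn_integral_lborel_translate[OF F] F_int
    by (intro add_mono order_refl Suc.IH Suc.prems) auto
  also have "\<dots> = ennreal (real (Suc j) * ?e) * osc k"
    using \<epsilon>_pos[of k] by (simp add: distrib_right ennreal_plus add_ac)
  finally show ?case .
qed simp

text \<open>A segment inside a ball contained in \<open>\<Omega>\<close> has a tube around it that stays in the domain of
  integration of \<open>osc k\<close> for all small \<open>\<epsilon> k\<close>.\<close>

lemma segment_margin:
  assumes "x \<in> ball z R" "x + s *\<^sub>R b \<in> ball z R" "0 \<le> s" "ball z R \<subseteq> \<Omega>"
  obtains r where "r > 0" "\<And>k y \<tau>. 4 * \<epsilon> k \<le> r \<Longrightarrow> y \<in> ball x r \<Longrightarrow> 0 \<le> \<tau> \<Longrightarrow> \<tau> \<le> s \<Longrightarrow>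
    y + \<tau> *\<^sub>R b \<in> core \<Omega> (4 * \<epsilon> k)"
proof -
  define R' where "R' = max (dist z x) (dist z (x + s *\<^sub>R b))"
  define r where "r = (R - R') / 2"
  have r: "r > 0" using assms by (simp add: r_def R'_def)
  have seg: "x + \<tau> *\<^sub>R b \<in> cball z R'" if "0 \<le> \<tau>" "\<tau> \<le> s" for \<tau>
  proof (cases "s = 0")
    case True
    then show ?thesis using that by (simp add: R'_def)
  next
    case False
    with assms have s: "s > 0" by simp
    have "closed_segment x (x + s *\<^sub>R b) \<subseteq> cball z R'"
      by (intro closed_segment_subset) (auto simp: R'_def)
    moreover have "x + \<tau> *\<^sub>R b = x + (\<tau> / s) *\<^sub>R (s *\<^sub>R b)"
      using s by simp
    then have "x + \<tau> *\<^sub>R b \<in> closed_segment x (x + s *\<^sub>R b)"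
      unfolding in_segment using s that
      by (intro exI[of _ "\<tau> / s"]) (simp add: algebra_simps)
    ultimately show ?thesis by blast
  qed
  show ?thesis
  proof (rule that[OF r])
    fix k y \<tau>
    assume *: "4 * \<epsilon> k \<le> r" "y \<in> ball x r" "0 \<le> \<tau>" "\<tau> \<le> s"
    have "ball (y + \<tau> *\<^sub>R b) (4 * \<epsilon> k) \<subseteq> ball z R"
    proof
      fix w assume w: "w \<in> ball (y + \<tau> *\<^sub>R b) (4 * \<epsilon> k)"
      have "dist z w \<le> dist z (x + \<tau> *\<^sub>R b) + dist (x + \<tau> *\<^sub>R b) (y + \<tau> *\<^sub>R b) + dist (y + \<tau> *\<^sub>R b) w"
        by (smt (verit) dist_triangle)
      also have "dist (x + \<tau> *\<^sub>R b) (y + \<tau> *\<^sub>R b) = dist x y"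
        by (simp add: dist_norm)
      finally show "w \<in> ball z R"
        using w * seg[of \<tau>] by (simp add: r_def field_simps)
    qed
    with assms(4) show "y + \<tau> *\<^sub>R b \<in> core \<Omega> (4 * \<epsilon> k)"
      unfolding core_def by auto
  qed
qed

lemma flat_translate:
  assumes flat: "flat a x" and s: "0 \<le> s"
    and x: "x \<in> ball z R" "x + s *\<^sub>R b \<in> ball z R" and z: "ball z R \<subseteq> \<Omega>"
  shows "flat a (x + s *\<^sub>R b)"
proof -
  obtain r1 where r1: "r1 > 0" "\<And>k y \<tau>. 4 * \<epsilon> k \<le> r1 \<Longrightarrow> y \<in> ball x r1 \<Longrightarrow> 0 \<le> \<tau> \<Longrightarrow> \<tau> \<le> s \<Longrightarrow>
    y + \<tau> *\<^sub>R b \<in> core \<Omega> (4 * \<epsilon> k)"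
    using segment_margin[OF x s z] by blast
  obtain r2 where r2: "r2 > 0" and lim: "(\<lambda>k. \<integral>\<^sup>+y\<in>ball x r2. ennreal (G k y) \<partial>lborel) \<longlonglongrightarrow> 0"
    using flat unfolding flat_def G_def by auto
  define r where "r = min r1 r2"
  have r: "r > 0" using r1 r2 by (simp add: r_def)
  let ?I = "\<lambda>k. \<integral>\<^sup>+y\<in>ball (x + s *\<^sub>R b) (r / 2). ennreal (G k y) \<partial>lborel"
  have "r / 4 > 0" using r by simp
  from eventually_\<epsilon>_less[OF this] have "\<forall>\<^sub>F k in sequentially. ?I k \<le>
      (\<integral>\<^sup>+y\<in>ball x r2. ennreal (G k y) \<partial>lborel) + ennreal s * osc k"
  proof eventually_elim
    case (elim k)
    define j where "j = steps s k"
    have js: "real j * \<epsilon> k \<le> s" "s - \<epsilon> k < real j * \<epsilon> k"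
      using steps_le steps_gt s by (auto simp: j_def)
    let ?c = "(real j * \<epsilon> k) *\<^sub>R b"
    define F where "F = (\<lambda>y. ennreal (G k y) * indicator (ball (x + s *\<^sub>R b) (r / 2)) y)"
    have F: "F \<in> borel_measurable borel"
      unfolding F_def by (intro borel_measurable_times_ennreal borel_measurable_indicator ball_borel) measurable
    have "?I k = (\<integral>\<^sup>+y. F (y + ?c) \<partial>lborel)"
      unfolding nn_integral_lborel_translate[OF F] by (simp add: F_def)
    also have "\<dots> \<le> (\<integral>\<^sup>+y. ennreal (G k y) * indicator (ball x r) y +
        ennreal \<bar>G k (y + ?c) - G k y\<bar> * indicator (ball x r) y \<partial>lborel)"
    proof (intro nn_integral_mono)
      fix y
      show "F (y + ?c) \<le> ennreal (G k y) * indicator (ball x r) y +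
        ennreal \<bar>G k (y + ?c) - G k y\<bar> * indicator (ball x r) y"
      proof (cases "y + ?c \<in> ball (x + s *\<^sub>R b) (r / 2)")
        case True
        have "norm ((s - real j * \<epsilon> k) *\<^sub>R b) \<le> \<epsilon> k * 1"
          unfolding norm_scaleR using js norm_b by (intro mult_mono) auto
        moreover have "dist x y \<le> dist (x + s *\<^sub>R b) (y + ?c) + norm ((s - real j * \<epsilon> k) *\<^sub>R b)"
          using norm_triangle_ineq4[of "x + s *\<^sub>R b - (y + ?c)" "(s - real j * \<epsilon> k) *\<^sub>R b"]
          by (simp add: dist_norm algebra_simps)
        ultimately have "y \<in> ball x r" using True elim r unfolding mem_ball by linarith
        moreover have "G k (y + ?c) \<le> G k y + \<bar>G k (y + ?c) - G k y\<bar>" by linarith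
        ultimately show ?thesis
          by (simp add: F_def indicator_def ennreal_plus[symmetric] ennreal_leI del: ennreal_plus)
      qed (simp add: F_def)
    qed
    also have "\<dots> = (\<integral>\<^sup>+y\<in>ball x r. ennreal (G k y) \<partial>lborel) +
        (\<integral>\<^sup>+y\<in>ball x r. ennreal \<bar>G k (y + ?c) - G k y\<bar> \<partial>lborel)"
    proof -
      have "(\<lambda>y. ennreal (G k y) * indicator (ball x r) y) \<in> borel_measurable borel"
        "(\<lambda>y. ennreal \<bar>G k (y + ?c) - G k y\<bar> * indicator (ball x r) y) \<in> borel_measurable borel"
        by (intro borel_measurable_times_ennreal borel_measurable_indicator ball_borel; measurable)+
      then show ?thesis by (simp add: nn_integral_add)
    qed
    also have "\<dots> \<le> (\<integral>\<^sup>+y\<in>ball x r2. ennreal (G k y) \<partial>lborel) + ennreal (real j * \<epsilon> k) * osc k"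
    proof (intro add_mono G_translate ball_borel)
      show "(\<integral>\<^sup>+y\<in>ball x r. ennreal (G k y) \<partial>lborel) \<le> (\<integral>\<^sup>+y\<in>ball x r2. ennreal (G k y) \<partial>lborel)"
        by (intro nn_integral_mono) (auto simp: indicator_def r_def)
      fix i y assume i: "i < j" and y: "y \<in> ball x r"
      have "real i * \<epsilon> k \<le> s"
        using mult_right_mono[of "real i" "real j" "\<epsilon> k"] \<epsilon>_pos[of k] i js(1) by linarith
      then show "y + (real i * \<epsilon> k) *\<^sub>R b \<in> core \<Omega> (4 * \<epsilon> k)"
        using y elim \<epsilon>_pos[of k] by (intro r1(2)) (auto simp: r_def)
    qed
    also have "\<dots> \<le> (\<integral>\<^sup>+y\<in>ball x r2. ennreal (G k y) \<partial>lborel) + ennreal s * osc k"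
      using js by (intro add_mono mult_right_mono ennreal_leI) auto
    finally show ?case .
  qed
  moreover have "(\<lambda>k. (\<integral>\<^sup>+y\<in>ball x r2. ennreal (G k y) \<partial>lborel) + ennreal s * osc k) \<longlonglongrightarrow> 0 + ennreal s * 0"
    by (intro tendsto_add ennreal_tendsto_cmult lim osc_lim) auto
  ultimately have "?I \<longlonglongrightarrow> 0"
    using ennreal_tendsto_0_le[where f="?I"] by simp
  then show ?thesis
    unfolding flat_def G_def using r by (intro exI[of _ "r / 2"]) auto
qed

text \<open>If \<open>u\<close> changes along \<open>b\<close> from \<open>x\<close>, then near \<open>x\<close> a constant multiple of the product of \<open>G k\<close>
  with the change of \<open>u\<close> bounds \<open>G k\<close> from above. That product, by telescoping, is at most
  \<open>\<epsilon> k\<close> times the sum over the steps of \<open>G k y * \<bar>diffq u (\<epsilon> k) b (y + i \<epsilon> b)\<bar>\<close>, and moving the argument of \<open>G k\<close> to \<open>y + i \<epsilon> b\<close> turns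
  each summand into a bounded multiple of an interaction density, up to an increment of \<open>G k\<close>.\<close>

lemma displaced_imp_flat:
  assumes ne: "u (x + s *\<^sub>R b) \<noteq> u x" and s: "0 \<le> s"
    and x: "x \<in> ball z R" "x + s *\<^sub>R b \<in> ball z R" and z: "ball z R \<subseteq> \<Omega>"
  shows "flat a x"
proof -
  obtain r1 where r1: "r1 > 0" "\<And>k y \<tau>. 4 * \<epsilon> k \<le> r1 \<Longrightarrow> y \<in> ball x r1 \<Longrightarrow> 0 \<le> \<tau> \<Longrightarrow> \<tau> \<le> s \<Longrightarrow>
    y + \<tau> *\<^sub>R b \<in> core \<Omega> (4 * \<epsilon> k)"
    using segment_margin[OF x s z] by blast
  define c where "c = \<bar>u (x + s *\<^sub>R b) - u x\<bar> / 2"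
  have c: "c > 0" using ne by (simp add: c_def)
  define r where "r = min r1 (c / (3 * L + 1))"
  have r: "r > 0" using r1 c L_nonneg unfolding r_def by auto
  have Lr: "3 * (L * r) \<le> c"
  proof -
    have "r \<le> c / (3 * L + 1)" by (simp add: r_def)
    then have "r * (3 * L + 1) \<le> c" using L_nonneg by (subst (asm) pos_le_divide_eq) auto
    then show ?thesis using r by (simp add: algebra_simps)
  qed
  let ?I = "\<lambda>k. \<integral>\<^sup>+y\<in>ball x r. ennreal (G k y) \<partial>lborel"
  have r4: "r / 4 > 0" using r by simp
  have "\<forall>\<^sub>F k in sequentially. ennreal c * ?I k \<le>
      ennreal (s * L) * (ennreal (\<epsilon> k) * interaction a b k + ennreal s * osc k)"
    using eventually_\<epsilon>_less[OF r4]
  proof eventually_elim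
    case (elim k)
    let ?e = "\<epsilon> k"
    have e: "?e > 0" by (rule \<epsilon>_pos)
    define j where "j = steps s k"
    have js: "real j * ?e \<le> s" "s - ?e < real j * ?e"
      using steps_le steps_gt s by (auto simp: j_def)
    let ?c = "\<lambda>i. (real i * ?e) *\<^sub>R b"
    have stay: "y + ?c i \<in> core \<Omega> (4 * ?e)" if i: "i < j" and y: "y \<in> ball x r" for i y
    proof -
      have "real i * ?e \<le> s"
        using mult_right_mono[of "real i" "real j" ?e] e i js(1) by linarith
      then show ?thesis
        using y elim e by (intro r1(2)) (auto simp: r_def)
    qed
    define D where "D = (\<lambda>y. \<bar>diffq u ?e a y\<bar> powr \<theta> * \<bar>diffq u ?e b y\<bar> / ?e)"
    define F where "F = (\<lambda>y. ennreal (D y) * indicator (core \<Omega> (2 * ?e)) y)"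
    define H where "H = (\<lambda>i y. ennreal \<bar>G k (y + ?c i) - G k y\<bar> * indicator (ball x r) y)"
    have F: "F \<in> borel_measurable borel"
      unfolding F_def D_def by (intro borel_measurable_times_ennreal borel_measurable_indicator core_borel) measurable
    have Fshift: "(\<lambda>y. F (y + w)) \<in> borel_measurable borel" for w
      by (rule measurable_compose[OF _ F]) measurable
    have H: "H i \<in> borel_measurable borel" for i
      unfolding H_def by (intro borel_measurable_times_ennreal borel_measurable_indicator ball_borel) measurable
    have pt: "c * G k y \<le> ?e * (\<Sum>i<j. L * (?e * D (y + ?c i) + \<bar>G k (y + ?c i) - G k y\<bar>))"
      if y: "y \<in> ball x r" for y
    proof -
      have xy: "norm (x - y) \<le> r" using y by (simp add: dist_norm)
      have "norm ((s - real j * ?e) *\<^sub>R b) \<le> r * 1"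
        unfolding norm_scaleR using js norm_b elim r by (intro mult_mono) auto
      then have "norm ((x - y) + (s - real j * ?e) *\<^sub>R b) \<le> 2 * r"
        using xy by (intro norm_triangle_le) linarith
      also have "(x - y) + (s - real j * ?e) *\<^sub>R b = x + s *\<^sub>R b - (y + ?c j)"
        by (simp add: algebra_simps)
      finally have "L * norm (x + s *\<^sub>R b - (y + ?c j)) \<le> L * (2 * r)"
        using L_nonneg by (rule mult_left_mono)
      then have 1: "\<bar>u (x + s *\<^sub>R b) - u (y + ?c j)\<bar> \<le> 2 * (L * r)"
        using lip_bound[of "x + s *\<^sub>R b" "y + ?c j"] by linarith
      have 2: "\<bar>u x - u y\<bar> \<le> L * r"
        using lip_bound[of x y] mult_left_mono[OF xy L_nonneg] by linarith
      have "2 * c \<le> \<bar>u (x + s *\<^sub>R b) - u (y + ?c j)\<bar> + \<bar>u (y + ?c j) - u y\<bar> + \<bar>u x - u y\<bar>"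
      proof -
        have "\<bar>p - q\<bar> \<le> \<bar>p - p'\<bar> + \<bar>p' - q\<bar>" "\<bar>p' - q\<bar> \<le> \<bar>p' - q'\<bar> + \<bar>q - q'\<bar>" for p q p' q' :: real
          by linarith+
        from this[of "u (x + s *\<^sub>R b)" "u x" "u (y + ?c j)"] this(2)[of "u (y + ?c j)" "u x" "u y"]
        show ?thesis unfolding c_def by simp
      qed
      with 1 2 Lr have "c \<le> \<bar>u (y + ?c j) - u y\<bar>"
        by linarith
      also have "\<dots> \<le> ?e * (\<Sum>i<j. \<bar>diffq u ?e b (y + ?c i)\<bar>)"
        by (rule telescope)
      finally have "c * G k y \<le> ?e * (\<Sum>i<j. \<bar>diffq u ?e b (y + ?c i)\<bar>) * G k y"
        by (intro mult_right_mono) auto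
      also have "\<dots> = ?e * (\<Sum>i<j. \<bar>diffq u ?e b (y + ?c i)\<bar> * G k y)"
        by (simp add: sum_distrib_right mult.assoc)
      also have "\<dots> \<le> ?e * (\<Sum>i<j. L * (?e * D (y + ?c i) + \<bar>G k (y + ?c i) - G k y\<bar>))"
      proof (intro mult_left_mono sum_mono)
        fix i
        let ?w = "y + ?c i"
        let ?p = "\<bar>diffq u ?e a ?w\<bar>" and ?q = "\<bar>diffq u ?e b ?w\<bar>"
        have p: "?p \<le> L" and q: "?q \<le> L"
          using e norm_a norm_b by (auto intro: diffq_bound)
        have "?q * G k y \<le> ?q * G k ?w + ?q * \<bar>G k ?w - G k y\<bar>"
          unfolding distrib_left[symmetric] by (intro mult_left_mono) auto
        also have "?q * \<bar>G k ?w - G k y\<bar> \<le> L * \<bar>G k ?w - G k y\<bar>"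
          using q by (intro mult_right_mono) auto
        also have "?q * G k ?w = ?p * (?e * D ?w)"
        proof -
          have "?e * D ?w = ?p powr \<theta> * ?q" using e by (simp add: D_def)
          moreover have "G k ?w = ?p powr \<theta> * ?p" by (simp add: G_def powr_add)
          ultimately show ?thesis by simp
        qed
        also have "\<dots> \<le> L * (?e * D ?w)"
          using p e by (intro mult_right_mono) (auto simp: D_def)
        finally show "?q * G k y \<le> L * (?e * D ?w + \<bar>G k ?w - G k y\<bar>)"
          by (simp add: distrib_left)
      qed (use e in auto)
      finally show ?thesis .
    qed
    have "ennreal c * ?I k = (\<integral>\<^sup>+y. ennreal c * (ennreal (G k y) * indicator (ball x r) y) \<partial>lborel)"
    proof -
      have "(\<lambda>y. ennreal (G k y) * indicator (ball x r) y) \<in> borel_measurable borel"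
        by (intro borel_measurable_times_ennreal borel_measurable_indicator ball_borel) measurable
      then show ?thesis by (simp add: nn_integral_cmult)
    qed
    also have "\<dots> \<le> (\<integral>\<^sup>+y. ennreal ?e * (\<Sum>i<j. ennreal L * (ennreal ?e * F (y + ?c i) + H i y)) \<partial>lborel)"
    proof (intro nn_integral_mono)
      fix y
      show "ennreal c * (ennreal (G k y) * indicator (ball x r) y)
        \<le> ennreal ?e * (\<Sum>i<j. ennreal L * (ennreal ?e * F (y + ?c i) + H i y))"
      proof (cases "y \<in> ball x r")
        case True
        have D0: "0 \<le> D w" for w using e by (simp add: D_def)
        have "ennreal c * (ennreal (G k y) * indicator (ball x r) y) = ennreal (c * G k y)"
          using True c by (simp add: ennreal_mult)
        also have "\<dots> \<le> ennreal (?e * (\<Sum>i<j. L * (?e * D (y + ?c i) + \<bar>G k (y + ?c i) - G k y\<bar>)))"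
          using pt[OF True] by (rule ennreal_leI)
        also have "\<dots> = ennreal ?e * (\<Sum>i<j. ennreal L * (ennreal ?e * ennreal (D (y + ?c i)) + ennreal \<bar>G k (y + ?c i) - G k y\<bar>))"
          using e L_nonneg D0 by (simp add: ennreal_mult sum_nonneg sum_ennreal[symmetric] ennreal_plus)
        also have "\<dots> = ennreal ?e * (\<Sum>i<j. ennreal L * (ennreal ?e * F (y + ?c i) + H i y))"
        proof (intro arg_cong2[where f="(*)"] refl sum.cong arg_cong2[where f="(+)"])
          fix i assume "i \<in> {..<j}"
          then have "y + ?c i \<in> core \<Omega> (4 * ?e)" using stay True by auto
          then have "y + ?c i \<in> core \<Omega> (2 * ?e)" using core_mono[of "2 * ?e" "4 * ?e" \<Omega>] e by auto
          then show "ennreal (D (y + ?c i)) = F (y + ?c i)" by (simp add: F_def)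
          show "ennreal \<bar>G k (y + ?c i) - G k y\<bar> = H i y" using True by (simp add: H_def)
        qed
        finally show ?thesis .
      qed simp
    qed
    also have "\<dots> = ennreal ?e * (\<Sum>i<j. ennreal L * (ennreal ?e * (\<integral>\<^sup>+y. F (y + ?c i) \<partial>lborel) + (\<integral>\<^sup>+y. H i y \<partial>lborel)))"
      using Fshift H by (simp add: nn_integral_cmult nn_integral_sum nn_integral_add)
    also have "\<dots> \<le> ennreal ?e * (\<Sum>i<j. ennreal L * (ennreal ?e * interaction a b k + ennreal s * osc k))"
    proof (intro mult_left_mono sum_mono add_mono)
      fix i assume i: "i \<in> {..<j}"
      show "(\<integral>\<^sup>+y. F (y + ?c i) \<partial>lborel) \<le> interaction a b k"
        unfolding nn_integral_lborel_translate[OF F] by (simp add: F_def D_def interaction_def)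
      have "real i * ?e \<le> s"
        using mult_right_mono[of "real i" "real j" ?e] e i[unfolded lessThan_iff] js(1) by linarith
      have "(\<integral>\<^sup>+y. H i y \<partial>lborel) \<le> ennreal (real i * ?e) * osc k"
        unfolding H_def using i stay by (intro G_translate ball_borel) auto
      also have "\<dots> \<le> ennreal s * osc k"
        using \<open>real i * ?e \<le> s\<close> by (intro mult_right_mono ennreal_leI) auto
      finally show "(\<integral>\<^sup>+y. H i y \<partial>lborel) \<le> ennreal s * osc k" .
    qed auto
    also have "\<dots> = ennreal (real j * ?e * L) * (ennreal ?e * interaction a b k + ennreal s * osc k)"
      using e L_nonneg by (simp add: ennreal_mult ennreal_of_nat_eq_real_of_nat mult_ac)
    also have "\<dots> \<le> ennreal (s * L) * (ennreal ?e * interaction a b k + ennreal s * osc k)"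
      using js(1) L_nonneg by (intro mult_right_mono ennreal_leI) auto
    finally show ?case .
  qed
  moreover have "(\<lambda>k. ennreal (s * L) * (ennreal (\<epsilon> k) * interaction a b k + ennreal s * osc k))
      \<longlonglongrightarrow> ennreal (s * L) * (ennreal 0 * 0 + ennreal s * 0)"
    by (intro ennreal_tendsto_cmult tendsto_add tendsto_mult_ennreal tendsto_ennrealI \<epsilon>_lim int_pp osc_lim) auto
  ultimately have "(\<lambda>k. ennreal c * ?I k) \<longlonglongrightarrow> 0"
    using ennreal_tendsto_0_le[where f="\<lambda>k. ennreal c * ?I k"] by simp
  then have "(\<lambda>k. ennreal (1 / c) * (ennreal c * ?I k)) \<longlonglongrightarrow> ennreal (1 / c) * 0"
    by (intro ennreal_tendsto_cmult) auto
  moreover have "ennreal (1 / c) * (ennreal c * w) = w" for w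
    using c by (simp add: mult.assoc[symmetric] ennreal_mult[symmetric])
  ultimately have "?I \<longlonglongrightarrow> 0" by simp
  then show ?thesis
    unfolding flat_def G_def using r by (intro exI[of _ r]) auto
qed

lemma forward_step:
  assumes "0 \<le> s" "x \<in> ball z R" "x + s *\<^sub>R b \<in> ball z R" "ball z R \<subseteq> \<Omega>"
  shows "loc_const_dir u a x \<Longrightarrow> loc_const_dir u a (x + s *\<^sub>R b)"
    and "\<not> loc_const_dir u a x \<Longrightarrow> u (x + s *\<^sub>R b) = u x"
  subgoal by (rule flat_translate[unfolded flat_iff, OF _ assms])
  subgoal using displaced_imp_flat[unfolded flat_iff, OF _ assms] by argo
  done

end

text \<open>The hypotheses are invariant under \<open>b \<mapsto> -b\<close>, which gives both signs of \<open>t\<close> and, by walking back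
  from \<open>x + t *\<^sub>R b\<close>, the equivalence.\<close>

lemma (in good_pair) propagation:
  assumes x: "x \<in> ball z R" "x + t *\<^sub>R b \<in> ball z R" and z: "ball z R \<subseteq> \<Omega>"
  shows "loc_const_dir u a x \<longleftrightarrow> loc_const_dir u a (x + t *\<^sub>R b)"
    and "\<not> loc_const_dir u a x \<Longrightarrow> u (x + t *\<^sub>R b) = u x"
proof -
  have neg: "good_pair u L \<Omega> \<epsilon> \<theta> a (- b)"
    by (intro good_pair.intro diffq_setting_axioms good_pair_axioms.intro)
      (simp_all add: norm_a norm_b int_pp int_pm int_mp int_mm)
  have "(loc_const_dir u a x \<longleftrightarrow> loc_const_dir u a (x + t *\<^sub>R b)) \<and>
      (\<not> loc_const_dir u a x \<longrightarrow> u (x + t *\<^sub>R b) = u x)"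
  proof (cases "0 \<le> t")
    case True
    have x': "x + t *\<^sub>R b + t *\<^sub>R - b \<in> ball z R" using x(1) by simp
    from forward_step[OF True x z] good_pair.forward_step[OF neg True x(2) x' z]
    show ?thesis by auto
  next
    case False
    then have t: "0 \<le> - t" by simp
    have x': "x + (- t) *\<^sub>R - b \<in> ball z R" "x + t *\<^sub>R b + (- t) *\<^sub>R b \<in> ball z R"
      using x by simp_all
    from good_pair.forward_step[OF neg t x(1) x'(1) z] forward_step[OF t x(2) x'(2) z]
    show ?thesis by auto
  qed
  then show "loc_const_dir u a x \<longleftrightarrow> loc_const_dir u a (x + t *\<^sub>R b)"
    "\<not> loc_const_dir u a x \<Longrightarrow> u (x + t *\<^sub>R b) = u x" by auto
qed

section \<open>From directional local constancy to one-sided dependence\<close>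

lemma loc_const_dir_scaleR:
  assumes "loc_const_dir f v x"
  shows "loc_const_dir f (c *\<^sub>R v) x"
proof -
  obtain r where r: "r > 0" "\<And>y t. y \<in> ball x r \<Longrightarrow> \<bar>t\<bar> < r \<Longrightarrow> f (y + t *\<^sub>R v) = f y"
    using assms unfolding loc_const_dir_def by blast
  define s where "s = r / (\<bar>c\<bar> + 1)"
  have c: "\<bar>c\<bar> + 1 > 0" by linarith
  have s: "s > 0" "s \<le> r"
    using r(1) c by (auto simp: s_def divide_simps intro: mult_right_le_one_le)
  have "\<bar>t * c\<bar> < r" if "\<bar>t\<bar> < s" for t
  proof -
    have "\<bar>t\<bar> * \<bar>c\<bar> \<le> \<bar>t\<bar> * (\<bar>c\<bar> + 1)" by (intro mult_left_mono) auto
    also have "\<dots> < s * (\<bar>c\<bar> + 1)" using that c by (rule mult_strict_right_mono)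
    also have "\<dots> = r" using c by (simp add: s_def)
    finally show ?thesis by (simp add: abs_mult)
  qed
  then show ?thesis
    unfolding loc_const_dir_def using s r(2)
    by (intro exI[of _ s]) auto
qed

lemma loc_const_dir_add:
  assumes "loc_const_dir f v x" "loc_const_dir f w x"
  shows "loc_const_dir f (v + w) x"
proof -
  obtain r1 where r1: "r1 > 0" "\<And>y t. y \<in> ball x r1 \<Longrightarrow> \<bar>t\<bar> < r1 \<Longrightarrow> f (y + t *\<^sub>R v) = f y"
    using assms(1) unfolding loc_const_dir_def by blast
  obtain r2 where r2: "r2 > 0" "\<And>y t. y \<in> ball x r2 \<Longrightarrow> \<bar>t\<bar> < r2 \<Longrightarrow> f (y + t *\<^sub>R w) = f y"
    using assms(2) unfolding loc_const_dir_def by blast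
  define r where "r = min r1 r2"
  have r: "r > 0" using r1 r2 by (simp add: r_def)
  define s where "s = r / (norm v + 1)"
  have n: "norm v + 1 > 0" by (rule add_nonneg_pos) auto
  have s: "s > 0" using r n by (simp add: s_def)
  have sv: "s + s * norm v = r"
  proof -
    have "s * (norm v + 1) = r" using n by (simp add: s_def)
    then show ?thesis by (simp add: distrib_left)
  qed
  have sr: "s \<le> r" using sv s by (smt (verit) mult_nonneg_nonneg norm_ge_zero)
  have "f (y + t *\<^sub>R (v + w)) = f y" if y: "y \<in> ball x (s / 2)" and t: "\<bar>t\<bar> < s / 2" for y t
  proof -
    have "\<bar>t\<bar> * norm v \<le> s / 2 * norm v" using t by (intro mult_right_mono) auto
    moreover have "dist x (y + t *\<^sub>R v) \<le> dist x y + \<bar>t\<bar> * norm v"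
      using dist_triangle[of x "y + t *\<^sub>R v" y] by (simp add: dist_norm)
    ultimately have "y + t *\<^sub>R v \<in> ball x r"
      using y sv r by simp
    then have "f ((y + t *\<^sub>R v) + t *\<^sub>R w) = f (y + t *\<^sub>R v)"
      using t s sr by (intro r2) (auto simp: r_def)
    moreover have "f (y + t *\<^sub>R v) = f y"
      using t s sr y by (intro r1) (auto simp: r_def)
    ultimately show ?thesis by (simp add: scaleR_add_right add.assoc)
  qed
  then show ?thesis
    unfolding loc_const_dir_def using s by (intro exI[of _ "s / 2"]) auto
qed

lemma loc_const_dir_span:
  assumes "\<And>v. v \<in> F \<Longrightarrow> loc_const_dir f v x" "v \<in> span F"
  shows "loc_const_dir f v x"
proof -
  have "subspace {v. loc_const_dir f v x}"
    unfolding subspace_def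
    by (auto intro: loc_const_dir_scaleR loc_const_dir_add)
      (auto simp: loc_const_dir_def intro: exI[of _ 1])
  then show ?thesis using assms span_minimal[of F "{v. loc_const_dir f v x}"] by blast
qed

lemma open_loc_const_dir: "open {x. loc_const_dir f v x}"
  unfolding open_contains_ball
proof
  fix x assume "x \<in> {x. loc_const_dir f v x}"
  then obtain r where r: "r > 0" "\<And>y t. y \<in> ball x r \<Longrightarrow> \<bar>t\<bar> < r \<Longrightarrow> f (y + t *\<^sub>R v) = f y"
    unfolding loc_const_dir_def by blast
  have "loc_const_dir f v y" if y: "y \<in> ball x (r / 2)" for y
    unfolding loc_const_dir_def
  proof (intro exI[of _ "r / 2"] conjI ballI allI impI)
    fix z t assume "z \<in> ball y (r / 2)" "\<bar>t\<bar> < r / 2"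
    then show "f (z + t *\<^sub>R v) = f z"
      using r(1) y dist_triangle[of x z y] by (intro r(2)) auto
  qed (use r in auto)
  then show "\<exists>s>0. ball x s \<subseteq> {x. loc_const_dir f v x}"
    using r by (intro exI[of _ "r / 2"]) auto
qed

lemma loc_const_dir_segment:
  assumes "\<And>\<tau>. 0 \<le> \<tau> \<Longrightarrow> \<tau> \<le> 1 \<Longrightarrow> loc_const_dir f v (x + \<tau> *\<^sub>R v)"
  shows "f (x + v) = f x"
proof -
  have "f (x + 1 *\<^sub>R v) = f (x + 0 *\<^sub>R v)"
  proof (rule connected_local_const[where A="{0..1}" and f="\<lambda>\<tau>. f (x + \<tau> *\<^sub>R v)"])
    show "\<forall>\<tau>\<in>{0..1}. \<forall>\<^sub>F \<sigma> in at \<tau> within {0..1}. f (x + \<tau> *\<^sub>R v) = f (x + \<sigma> *\<^sub>R v)"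
    proof
      fix \<tau> :: real assume "\<tau> \<in> {0..1}"
      then obtain r where r: "r > 0"
        "\<And>y t. y \<in> ball (x + \<tau> *\<^sub>R v) r \<Longrightarrow> \<bar>t\<bar> < r \<Longrightarrow> f (y + t *\<^sub>R v) = f y"
        using assms[of \<tau>] unfolding loc_const_dir_def by auto
      have "f (x + \<tau> *\<^sub>R v) = f (x + \<sigma> *\<^sub>R v)" if "dist \<sigma> \<tau> < r" for \<sigma>
        using r(2)[of "x + \<tau> *\<^sub>R v" "\<sigma> - \<tau>"] r(1) that
        by (simp add: dist_real_def algebra_simps)
      then show "\<forall>\<^sub>F \<sigma> in at \<tau> within {0..1}. f (x + \<tau> *\<^sub>R v) = f (x + \<sigma> *\<^sub>R v)"
        unfolding eventually_at using r(1) by blast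
    qed
  qed auto
  then show ?thesis by simp
qed

lemma loc_const_dir_ball:
  assumes "\<And>y v. y \<in> ball x r \<Longrightarrow> v \<in> F \<Longrightarrow> loc_const_dir f v y"
    and "y \<in> ball x r" "z \<in> ball x r" "z - y \<in> span F"
  shows "f z = f y"
proof -
  have "f (y + (z - y)) = f y"
  proof (rule loc_const_dir_segment)
    fix \<tau> :: real assume "0 \<le> \<tau>" "\<tau> \<le> 1"
    then have "y + \<tau> *\<^sub>R (z - y) \<in> closed_segment y z"
      unfolding in_segment by (intro exI[of _ \<tau>]) (simp add: algebra_simps)
    moreover have "closed_segment y z \<subseteq> ball x r"
      using assms by (intro closed_segment_subset) auto
    ultimately have "y + \<tau> *\<^sub>R (z - y) \<in> ball x r" by blast
    from loc_const_dir_span[OF assms(1)[OF this] assms(4)]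
    show "loc_const_dir f (z - y) (y + \<tau> *\<^sub>R (z - y))" .
  qed
  then show ?thesis by simp
qed

lemma loc_const_dir_slice:
  assumes \<Omega>: "open \<Omega>" and f: "\<And>x v. x \<in> \<Omega> \<Longrightarrow> v \<in> F \<Longrightarrow> loc_const_dir f v x"
    and A: "connected A" "A \<subseteq> span F" "\<And>y. y \<in> A \<Longrightarrow> p + y \<in> \<Omega>"
    and y: "y \<in> A" "z \<in> A"
  shows "f (p + y) = f (p + z)"
proof (rule connected_local_const[OF A(1) y, where f="\<lambda>y. f (p + y)"], rule ballI)
  fix y assume y: "y \<in> A"
  then obtain r where r: "r > 0" "ball (p + y) r \<subseteq> \<Omega>"
    using A(3) \<Omega> open_contains_ball by blast
  have "f (p + y) = f (p + z)" if z: "z \<in> A" "dist z y < r" for z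
  proof (rule loc_const_dir_ball[where x="p + y" and r=r and F=F])
    show "p + y - (p + z) \<in> span F"
      using y z A(2) by (auto intro: span_diff)
    show "loc_const_dir f v w" if "w \<in> ball (p + y) r" "v \<in> F" for w v
      using f r(2) that by blast
  qed (use r(1) z in \<open>auto simp: dist_commute\<close>)
  then show "\<forall>\<^sub>F z in at y within A. f (p + y) = f (p + z)"
    unfolding eventually_at using r(1) by blast
qed

text \<open>This function records whether \<open>u\<close> is locally constant in direction \<open>e\<close> at \<open>x\<close>, and the value
  of \<open>u\<close> if it is not. Its local constancy in direction \<open>b\<close> combines the two statements of
  \<open>propagation\<close>.\<close>

definition rigidity_state :: "('a::real_normed_vector \<Rightarrow> 'b) \<Rightarrow> 'a \<Rightarrow> 'a \<Rightarrow> 'b option" where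
  "rigidity_state u e x = (if loc_const_dir u e x then None else Some (u x))"

lemma (in good_pair) rigidity_state_loc_const:
  assumes "open \<Omega>" "x \<in> \<Omega>"
  shows "loc_const_dir (rigidity_state u a) b x"
proof -
  obtain R where R: "R > 0" "ball x R \<subseteq> \<Omega>"
    using assms open_contains_ball by blast
  show ?thesis
    unfolding loc_const_dir_def
  proof (intro exI[of _ "R / 2"] conjI ballI allI impI)
    fix y t assume y: "y \<in> ball x (R / 2)" and t: "\<bar>t\<bar> < R / 2"
    have "\<bar>t\<bar> * norm b \<le> R / 2 * 1" using t norm_b by (intro mult_mono) auto
    moreover have "dist x (y + t *\<^sub>R b) \<le> dist x y + \<bar>t\<bar> * norm b"
      using dist_triangle[of x "y + t *\<^sub>R b" y] by (simp add: dist_norm)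
    ultimately have "y \<in> ball x R" "y + t *\<^sub>R b \<in> ball x R" using y R(1) by auto
    from propagation[OF this R(2)]
    show "rigidity_state u a (y + t *\<^sub>R b) = rigidity_state u a y"
      by (auto simp: rigidity_state_def)
  qed (use R in auto)
qed

lemma one_sided_dependence:
  fixes u :: "'a::euclidean_space \<Rightarrow> real"
  assumes \<Omega>: "open (\<Omega>1 + \<Omega>2)" and u: "continuous_on UNIV u"
    and \<Omega>1: "\<Omega>1 \<subseteq> span E" "connected \<Omega>1" and \<Omega>2: "connected \<Omega>2"
    and E: "\<And>e. e \<in> E \<Longrightarrow> \<exists>F. \<Omega>2 \<subseteq> span F \<and>
        (\<forall>f\<in>F. \<forall>x\<in>\<Omega>1 + \<Omega>2. loc_const_dir (rigidity_state u e) f x)"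
  shows "(\<forall>x\<in>\<Omega>1. \<forall>y\<in>\<Omega>2. \<forall>y'\<in>\<Omega>2. u (x + y) = u (x + y')) \<or>
         (\<forall>y\<in>\<Omega>2. \<forall>x\<in>\<Omega>1. \<forall>x'\<in>\<Omega>1. u (x + y) = u (x' + y))"
proof -
  obtain B where B: "B \<subseteq> E" "independent B" "span E = span B"
    using maximal_independent_subset[of E] by (metis span_mono span_span subset_antisym)
  have "finite B" using B(2) by (rule independent_imp_finite)
  \<comment> \<open>On each slice \<open>{x} + \<Omega>2\<close>, either \<open>u\<close> is locally constant in direction \<open>e\<close> everywhere, or
    nowhere, and then \<open>u\<close> is constant on the slice.\<close>
  have state: "rigidity_state u e (x + y) = rigidity_state u e (x + y')"
    if "e \<in> B" "x \<in> \<Omega>1" "y \<in> \<Omega>2" "y' \<in> \<Omega>2" for e x y y'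
  proof -
    have "e \<in> E" using that(1) B(1) by blast
    from E[OF this] obtain F where F: "\<Omega>2 \<subseteq> span F"
      "\<forall>f\<in>F. \<forall>x\<in>\<Omega>1 + \<Omega>2. loc_const_dir (rigidity_state u e) f x"
      by auto
    show ?thesis
      using F that \<Omega> \<Omega>2 by (intro loc_const_dir_slice[where A=\<Omega>2 and F=F and \<Omega>="\<Omega>1 + \<Omega>2"]) (auto intro: set_plus_intro)
  qed
  have free: "u (x + y) = u (x + y')"
    if "x \<in> \<Omega>1" "y0 \<in> \<Omega>2" "e \<in> B" "\<not> loc_const_dir u e (x + y0)" "y \<in> \<Omega>2" "y' \<in> \<Omega>2" for x y0 e y y'
  proof -
    have "rigidity_state u e (x + y) = Some (u (x + y0))" "rigidity_state u e (x + y') = Some (u (x + y0))"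
      using state[of e x y y0] state[of e x y' y0] that by (auto simp: rigidity_state_def)
    then show ?thesis by (auto simp: rigidity_state_def split: if_splits)
  qed
  show ?thesis
  proof (cases "\<forall>e\<in>B. \<forall>x\<in>\<Omega>1 + \<Omega>2. loc_const_dir u e x")
    case True
    have "u (x + y) = u (x' + y)" if "x \<in> \<Omega>1" "x' \<in> \<Omega>1" "y \<in> \<Omega>2" for x x' y
      using loc_const_dir_slice[OF \<Omega>, of B u \<Omega>1 y x x'] True \<Omega>1 B that
      by (simp add: add.commute set_plus_intro)
    then show ?thesis by blast
  next
    case False
    then obtain e w y0 where w: "e \<in> B" "w \<in> \<Omega>1" "y0 \<in> \<Omega>2" "\<not> loc_const_dir u e (w + y0)"
      by (auto simp: set_plus_def)
    have "u (x + y) = u (x + y')" if x: "x \<in> \<Omega>1" and y: "y \<in> \<Omega>2" "y' \<in> \<Omega>2" for x y y'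
    proof (rule ccontr)
      define g where "g = (\<lambda>x. u (x + y) - u (x + y'))"
      assume "u (x + y) \<noteq> u (x + y')"
      then have gx: "g x \<noteq> 0" by (simp add: g_def)
      have gw: "g w = 0" using free[of w y0 e y y'] w y by (simp add: g_def)
      have g_cont: "continuous_on \<Omega>1 g"
        unfolding g_def by (intro continuous_intros continuous_on_compose2[OF u]) auto
      have "(g x = g x) = (g w = g x)"
      proof (rule connected_local_const[OF \<Omega>1(2) x w(2), where f="\<lambda>z. g z = g x"], rule ballI)
        fix z assume z: "z \<in> \<Omega>1"
        show "\<forall>\<^sub>F z' in at z within \<Omega>1. (g z = g x) = (g z' = g x)"
        proof (cases "g z = g x")
          case True
          \<comment> \<open>As \<open>g z \<noteq> 0\<close>, the function \<open>u\<close> is not constant on the slice through \<open>z\<close>, so it is locally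
            constant there in all directions of \<open>span B\<close>. Finiteness of \<open>B\<close> makes this an open
            condition.\<close>
          have "\<exists>r>0. \<forall>z'\<in>\<Omega>1. dist z' z < r \<longrightarrow> u (z' + t) = u (z + t)" if t: "t \<in> \<Omega>2" for t
          proof -
            have "loc_const_dir u e' (z + t)" if "e' \<in> B" for e'
              using free[of z t e' y y'] True gx z t that y by (auto simp: g_def)
            then have "z + t \<in> (\<Inter>e'\<in>B. {x. loc_const_dir u e' x})" by auto
            moreover have "open (\<Inter>e'\<in>B. {x. loc_const_dir u e' x})"
              using \<open>finite B\<close> by (intro open_INT ballI open_loc_const_dir)
            ultimately obtain r where r: "r > 0" "ball (z + t) r \<subseteq> (\<Inter>e'\<in>B. {x. loc_const_dir u e' x})"
              using open_contains_ball by blast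
            have "u (z' + t) = u (z + t)" if z': "z' \<in> \<Omega>1" "dist z' z < r" for z'
            proof (rule loc_const_dir_ball[where x="z + t" and r=r and F=B])
              show "z' + t - (z + t) \<in> span B"
                using z z' \<Omega>1(1) B(3) by (auto intro: span_diff)
              show "loc_const_dir u v w" if "w \<in> ball (z + t) r" "v \<in> B" for w v
                using r(2) that by blast
            qed (use r(1) z' in \<open>auto simp: dist_commute\<close>)
            with r(1) show ?thesis by blast
          qed
          from this[OF y(1)] this[OF y(2)] obtain r r' where
            "r > 0" "\<And>z'. z' \<in> \<Omega>1 \<Longrightarrow> dist z' z < r \<Longrightarrow> u (z' + y) = u (z + y)"
            "r' > 0" "\<And>z'. z' \<in> \<Omega>1 \<Longrightarrow> dist z' z < r' \<Longrightarrow> u (z' + y') = u (z + y')"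
            by blast
          then show ?thesis
            unfolding eventually_at g_def by (intro exI[of _ "min r r'"]) auto
        next
          case False
          have "(g \<longlongrightarrow> g z) (at z within \<Omega>1)"
            using g_cont z by (simp add: continuous_on_def)
          then have "\<forall>\<^sub>F z' in at z within \<Omega>1. g z' \<noteq> g x"
            using False by (rule tendsto_imp_eventually_ne)
          then show ?thesis
            by eventually_elim (use False in auto)
        qed
      qed
      with gx gw show False by simp
    qed
    then show ?thesis by blast
  qed
qed

section \<open>Lipschitz extension\<close>

text \<open>McShane's extension: the largest \<open>L\<close>-Lipschitz function that agrees with \<open>u\<close> on \<open>S\<close>.\<close>

lemma lipschitz_extension:
  fixes u :: "'a::metric_space \<Rightarrow> real"
  assumes "L-lipschitz_on S u" "S \<noteq> {}"
  obtains v where "L-lipschitz_on UNIV v" "\<And>x. x \<in> S \<Longrightarrow> v x = u x"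
proof -
  have L: "0 \<le> L" using assms(1) by (rule lipschitz_on_nonneg)
  have lip: "u x \<le> u y + L * dist x y" if "x \<in> S" "y \<in> S" for x y
    using lipschitz_onD[OF assms(1) that] by (simp add: dist_real_def)
  define v where "v = (\<lambda>x. INF y\<in>S. u y + L * dist x y)"
  have bdd: "bdd_below ((\<lambda>y. u y + L * dist x y) ` S)" for x
  proof -
    obtain s where s: "s \<in> S" using assms(2) by blast
    have "u s - L * dist x s \<le> u y + L * dist x y" if "y \<in> S" for y
    proof -
      have "L * dist s y \<le> L * (dist x s + dist x y)"
        using L by (intro mult_left_mono dist_triangle3)
      with lip[OF s that] show ?thesis by (simp add: distrib_left dist_commute)
    qed
    then show ?thesis by (intro bdd_belowI2)
  qed
  have "v x \<le> v x' + L * dist x x'" for x x'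
  proof -
    have "v x - L * dist x x' \<le> v x'"
      unfolding v_def[THEN fun_cong, of x']
    proof (intro cINF_greatest assms(2))
      fix y assume y: "y \<in> S"
      have "v x \<le> u y + L * dist x y"
        unfolding v_def using bdd y by (intro cINF_lower)
      also have "L * dist x y \<le> L * (dist x x' + dist x' y)"
        using L by (intro mult_left_mono dist_triangle)
      finally show "v x - L * dist x x' \<le> u y + L * dist x' y" by (simp add: distrib_left)
    qed
    then show ?thesis by simp
  qed
  note v_lip = this
  have "L-lipschitz_on UNIV v"
  proof (rule lipschitz_onI[OF _ L])
    fix x y show "dist (v x) (v y) \<le> L * dist x y"
      using v_lip[of x y] v_lip[of y x] by (simp add: dist_real_def dist_commute abs_le_iff)
  qed
  moreover have "v x = u x" if x: "x \<in> S" for x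
  proof (rule antisym)
    show "v x \<le> u x"
      unfolding v_def using cINF_lower[OF bdd x, of x] by simp
    show "u x \<le> v x"
      unfolding v_def using x lip by (intro cINF_greatest) auto
  qed
  ultimately show ?thesis using that by blast
qed

section \<open>Orthogonal decompositions and directions of positive measure\<close>

lemma null_sets_linear_vimage_subspace:
  fixes P :: "'a::euclidean_space \<Rightarrow> 'b::euclidean_space"
  assumes "linear P" "subspace K" "P x \<notin> K"
  shows "{q. P q \<in> K} \<in> null_sets lborel"
proof -
  have sub: "subspace {q. P q \<in> K}"
    using assms(2) by (simp add: subspace_def linear_0[OF assms(1)] linear_add[OF assms(1)] linear_scale[OF assms(1)])
  have "{q. P q \<in> K} \<noteq> UNIV" using assms(3) by blast
  then have "dim {q. P q \<in> K} \<noteq> DIM('a)"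
    using sub by (metis dim_eq_full span_eq_iff)
  then have "dim {q. P q \<in> K} < DIM('a)"
    using dim_subset_UNIV[of "{q. P q \<in> K}"] by linarith
  then have "negligible {q. P q \<in> K}" by (rule negligible_lowdim)
  moreover have "{q. P q \<in> K} \<in> sets lborel"
    using closed_subspace[OF sub] by simp
  ultimately show ?thesis
    by (simp add: negligible_iff_null_sets null_sets_completion_iff)
qed

locale orthogonal_decomposition =
  fixes X1 X2 :: "'a::euclidean_space set"
  assumes sub1: "subspace X1" and sub2: "subspace X2"
    and orth: "\<And>x y. x \<in> X1 \<Longrightarrow> y \<in> X2 \<Longrightarrow> orthogonal x y"
    and total: "X1 + X2 = UNIV"
begin

abbreviation pr1 :: "'a \<Rightarrow> 'a" where "pr1 \<equiv> component X1 X2"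
abbreviation pr2 :: "'a \<Rightarrow> 'a" where "pr2 \<equiv> component X2 X1"

lemma X1_Int_X2: "x \<in> X1 \<Longrightarrow> x \<in> X2 \<Longrightarrow> x = 0"
  using orth[of x x] by (simp add: orthogonal_self)

lemma pr1_add: "e \<in> X1 \<Longrightarrow> f \<in> X2 \<Longrightarrow> pr1 (e + f) = e"
  unfolding component_def
proof (rule the_equality)
  fix v assume ef: "e \<in> X1" "f \<in> X2" and v: "v \<in> X1 \<and> e + f - v \<in> X2"
  have "e - v \<in> X1" using ef v sub1 by (auto intro: subspace_diff)
  moreover have "(e + f - v) - f \<in> X2" using ef v sub2 by (blast intro: subspace_diff)
  then have "e - v \<in> X2" by (simp add: algebra_simps)
  ultimately have "e - v = 0" by (rule X1_Int_X2)
  then show "v = e" by simp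
qed simp

lemma pr2_add: "e \<in> X1 \<Longrightarrow> f \<in> X2 \<Longrightarrow> pr2 (e + f) = f"
  unfolding component_def
proof (rule the_equality)
  fix v assume ef: "e \<in> X1" "f \<in> X2" and v: "v \<in> X2 \<and> e + f - v \<in> X1"
  have "f - v \<in> X2" using ef v sub2 by (auto intro: subspace_diff)
  moreover have "(e + f - v) - e \<in> X1" using ef v sub1 by (blast intro: subspace_diff)
  then have "f - v \<in> X1" by (simp add: algebra_simps)
  from X1_Int_X2[OF this] \<open>f - v \<in> X2\<close> show "v = f" by simp
qed simp

lemma decompose: obtains e f where "e \<in> X1" "f \<in> X2" "x = e + f"
  using total set_plus_elim[of x X1 X2] by (metis UNIV_I)

lemma pr1_in: "pr1 x \<in> X1" and pr2_in: "pr2 x \<in> X2" and pr_sum: "pr1 x + pr2 x = x"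
  by (rule decompose[of x]; simp add: pr1_add pr2_add)+

lemma linear_pr1: "linear pr1"
proof (rule linearI)
  fix x y :: 'a and c :: real
  have "pr1 ((pr1 x + pr1 y) + (pr2 x + pr2 y)) = pr1 x + pr1 y"
    using sub1 sub2 pr1_in pr2_in by (intro pr1_add subspace_add)
  moreover have "(pr1 x + pr1 y) + (pr2 x + pr2 y) = x + y"
    using pr_sum[of x] pr_sum[of y] by (metis add.assoc add.left_commute)
  ultimately show "pr1 (x + y) = pr1 x + pr1 y" by simp
  have "pr1 (c *\<^sub>R pr1 x + c *\<^sub>R pr2 x) = c *\<^sub>R pr1 x"
    using sub1 sub2 pr1_in pr2_in by (intro pr1_add subspace_scale)
  then show "pr1 (c *\<^sub>R x) = c *\<^sub>R pr1 x"
    by (simp add: scaleR_add_right[symmetric] pr_sum)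
qed

lemma swap: "orthogonal_decomposition X2 X1"
  by unfold_locales (use sub1 sub2 orth total orthogonal_commute add.commute in metis)+

lemma linear_pr2: "linear pr2"
  by (rule orthogonal_decomposition.linear_pr1[OF swap])

lemma norm_pr: "(norm x)\<^sup>2 = (norm (pr1 x))\<^sup>2 + (norm (pr2 x))\<^sup>2"
  using norm_add_Pythagorean[OF orth[OF pr1_in[of x] pr2_in[of x]]] by (simp add: pr_sum)

lemma norm_pr1_le: "norm (pr1 x) \<le> norm x" and norm_pr2_le: "norm (pr2 x) \<le> norm x"
  by (rule power2_le_imp_le; simp add: norm_pr[of x])+

lemma pr1_borel [measurable]: "pr1 \<in> borel_measurable borel"
  and pr2_borel [measurable]: "pr2 \<in> borel_measurable borel"
  by (intro borel_measurable_continuous_onI linear_continuous_on linear_linear[THEN iffD2]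
      linear_pr1 linear_pr2 linear_conv_bounded_linear[THEN iffD1])+

text \<open>For \<open>s, t \<in> {1, -1}\<close> these are the reflections in the two subspaces and their compositions.\<close>

definition reflect :: "real \<Rightarrow> real \<Rightarrow> 'a \<Rightarrow> 'a" where
  "reflect s t y = s *\<^sub>R pr1 y + t *\<^sub>R pr2 y"

lemma linear_reflect: "linear (reflect s t)"
  unfolding reflect_def[abs_def]
  by (intro linear_compose_add linear_compose_scale_right linear_pr1 linear_pr2)

lemma pr1_reflect: "pr1 (reflect s t y) = s *\<^sub>R pr1 y"
  and pr2_reflect: "pr2 (reflect s t y) = t *\<^sub>R pr2 y"
  unfolding reflect_def using sub1 sub2 pr1_in pr2_in
  by (intro pr1_add pr2_add subspace_scale; simp)+

lemma reflect_reflect: "s * s = 1 \<Longrightarrow> t * t = 1 \<Longrightarrow> reflect s t (reflect s t y) = y"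
  unfolding reflect_def[of s t "reflect s t y"] by (simp add: pr1_reflect pr2_reflect pr_sum)

lemma norm_reflect:
  assumes "s * s = 1" "t * t = 1"
  shows "norm (reflect s t y) = norm y"
proof -
  have "\<bar>s\<bar> = 1" "\<bar>t\<bar> = 1" using assms by (auto simp: square_eq_1_iff)
  then have "(norm (reflect s t y))\<^sup>2 = (norm y)\<^sup>2"
    unfolding norm_pr[of y] norm_pr[of "reflect s t y"] pr1_reflect pr2_reflect by simp
  then show ?thesis by simp
qed

lemma negligible_reflect_vimage:
  assumes "negligible N" "s * s = 1" "t * t = 1"
  shows "negligible {y. reflect s t y \<in> N}"
proof -
  have "{y. reflect s t y \<in> N} \<subseteq> reflect s t ` N"
  proof
    fix y assume "y \<in> {y. reflect s t y \<in> N}"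
    then have "reflect s t (reflect s t y) \<in> reflect s t ` N" by blast
    then show "y \<in> reflect s t ` N" by (simp only: reflect_reflect[OF assms(2,3)])
  qed
  moreover have "negligible (reflect s t ` N)"
    using assms(1) linear_reflect
    by (intro negligible_differentiable_image_negligible linear_imp_differentiable_on) auto
  ultimately show ?thesis using negligible_subset by blast
qed

text \<open>Fubini's theorem for the splitting \<open>X1 + X2\<close>. The linear involution \<open>swp\<close> of the product space,
  which exchanges the \<open>X2\<close>-components of the two factors, maps the set of pairs \<open>(p, q)\<close> with
  \<open>pr1 p + pr2 q \<in> S\<close> onto \<open>S \<times> UNIV\<close>. Hence the product measure on pairs can be used instead of
  Lebesgue measures on \<open>X1\<close> and \<open>X2\<close>.\<close>

lemma negligible_of_AE_sections:
  assumes S: "S \<in> sets borel" and AE: "AE p in lborel. AE q in lborel. pr1 p + pr2 q \<notin> S"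
  shows "negligible S"
proof -
  define swp where "swp = (\<lambda>(p, q). (pr1 p + pr2 q, pr1 q + pr2 p))"
  have [simp]: "pr1 (pr1 p + pr2 q) = pr1 p" "pr2 (pr1 p + pr2 q) = pr2 q" for p q
    by (simp_all add: pr1_add pr2_add pr1_in pr2_in)
  have swp_swp: "swp (swp w) = w" for w
    by (cases w) (simp add: swp_def pr_sum)
  have lin: "linear swp"
    unfolding swp_def case_prod_beta
    by (rule linearI) (simp_all add: linear_add[OF linear_pr1] linear_add[OF linear_pr2]
        linear_scale[OF linear_pr1] linear_scale[OF linear_pr2] scaleR_add_right)
  define T where "T = {w. fst (swp w) \<in> S}"
  have T_eq: "T = swp ` (S \<times> UNIV)"
  proof (intro set_eqI iffI)
    fix w assume "w \<in> T"
    then have "swp (swp w) \<in> swp ` (S \<times> UNIV)" by (intro imageI) (simp add: T_def mem_Times_iff)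
    then show "w \<in> swp ` (S \<times> UNIV)" by (simp only: swp_swp)
  qed (auto simp: T_def swp_swp)
  have T: "T \<in> sets borel"
  proof -
    have "continuous_on UNIV (\<lambda>w. fst (swp w))"
      by (intro continuous_on_fst linear_continuous_on linear_conv_bounded_linear[THEN iffD1] lin)
    then have "(\<lambda>w. fst (swp w)) \<in> borel_measurable borel"
      by (rule borel_measurable_continuous_onI)
    from measurable_sets[OF this S] show ?thesis by (simp add: T_def vimage_def)
  qed
  have "AE w in lborel \<Otimes>\<^sub>M lborel. w \<notin> T"
  proof (rule lborel_pair.AE_pair_measure)
    show "{w \<in> space (lborel \<Otimes>\<^sub>M lborel). w \<notin> T} \<in> sets (lborel \<Otimes>\<^sub>M (lborel :: 'a measure))"
      using T unfolding lborel_prod by (simp add: Collect_neg_eq[symmetric] sets.compl_sets)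
    show "AE x in lborel. AE y in lborel. (x, y) \<notin> T"
      using AE by (simp add: T_def swp_def)
  qed
  then have "AE w in lborel. w \<notin> T" unfolding lborel_prod .
  then have "T \<in> null_sets lborel"
    using T by (subst (asm) AE_iff_null_sets[symmetric]) simp_all
  then have "negligible T"
    by (simp add: negligible_iff_null_sets null_sets_completionI)
  then have "negligible (swp ` T)"
    using lin by (intro negligible_differentiable_image_negligible linear_imp_differentiable_on) auto
  also have "swp ` T = S \<times> UNIV"
    unfolding T_eq by (simp add: image_image swp_swp)
  finally have "S \<times> UNIV \<in> null_sets (lborel :: ('a \<times> 'a) measure)"
    using S by (simp add: negligible_iff_null_sets null_sets_completion_iff flip: lborel_prod)
  then have "emeasure (lborel \<Otimes>\<^sub>M lborel) (S \<times> (UNIV :: 'a set)) = 0"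
    by (auto simp: lborel_prod)
  then have "emeasure lborel S * emeasure lborel (UNIV :: 'a set) = 0"
    using S by (subst (asm) lborel.emeasure_pair_measure_Times) auto
  then have "S \<in> null_sets lborel"
    using S by (auto intro: null_setsI)
  then show ?thesis
    by (simp add: negligible_iff_null_sets null_sets_completionI)
qed

text \<open>Otherwise, for almost every \<open>p\<close> the directions \<open>f\<close> with \<open>pr1 p + f \<in> D\<close> lie in a proper subspace
  of \<open>X2\<close>, and \<open>D\<close> would be negligible.\<close>

lemma spanning_directions:
  assumes D: "D \<in> sets lebesgue" "\<not> negligible D"
  shows "span {e \<in> X1. span {f \<in> X2. e + f \<in> D} = X2} = X1"
proof (rule ccontr)
  let ?F = "\<lambda>e. {f \<in> X2. e + f \<in> D}"
  let ?E = "{e \<in> X1. span (?F e) = X2}"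
  assume ne: "span ?E \<noteq> X1"
  have "span ?E \<subseteq> X1" using sub1 by (intro span_minimal) auto
  with ne obtain x where x: "x \<in> X1" "x \<notin> span ?E" by blast
  obtain S N N' where S: "D = S \<union> N" "N \<subseteq> N'" "N' \<in> null_sets lborel" "S \<in> sets lborel"
    using sets_completionE[OF D(1)] by blast
  have "pr1 x = x" using pr1_add[of x 0] x sub2 by (simp add: subspace_0)
  then have "{p. pr1 p \<in> span ?E} \<in> null_sets lborel"
    using x by (intro null_sets_linear_vimage_subspace[of _ _ x] linear_pr1) auto
  from AE_not_in[OF this] have "AE p in lborel. AE q in lborel. pr1 p + pr2 q \<notin> S"
  proof eventually_elim
    case (elim p)
    let ?K = "span (?F (pr1 p))"
    have "?K \<subseteq> X2" using sub2 by (intro span_minimal) auto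
    moreover have "?K \<noteq> X2" using elim pr1_in span_base[of "pr1 p" ?E] by blast
    ultimately obtain y where y: "y \<in> X2" "y \<notin> ?K" by blast
    have "pr2 y = y" using pr2_add[of 0 y] y sub1 by (simp add: subspace_0)
    then have "{q. pr2 q \<in> ?K} \<in> null_sets lborel"
      using y by (intro null_sets_linear_vimage_subspace[of _ _ y] linear_pr2) auto
    from AE_not_in[OF this] show ?case
    proof eventually_elim
      case (elim q)
      then show ?case using span_base[of "pr2 q" "?F (pr1 p)"] pr2_in S(1) by blast
    qed
  qed
  then have "negligible S"
    using S(4) by (intro negligible_of_AE_sections) auto
  moreover have "negligible N"
    using S(2,3) by (meson negligible_iff_null_sets negligible_subset null_sets_completionI)
  ultimately show False using D(2) S(1) by (simp add: negligible_Un)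
qed

lemma open_sum:
  assumes "openin (top_of_set X1) \<Omega>1" "openin (top_of_set X2) \<Omega>2"
  shows "open (\<Omega>1 + \<Omega>2)"
proof -
  obtain T1 T2 where T: "open T1" "\<Omega>1 = X1 \<inter> T1" "open T2" "\<Omega>2 = X2 \<inter> T2"
    using assms by (auto simp: openin_open)
  have "\<Omega>1 + \<Omega>2 = pr1 -` T1 \<inter> pr2 -` T2"
  proof (intro set_eqI iffI)
    fix x assume "x \<in> \<Omega>1 + \<Omega>2"
    then show "x \<in> pr1 -` T1 \<inter> pr2 -` T2"
      by (auto simp: T pr1_add pr2_add elim!: set_plus_elim)
  next
    fix x assume "x \<in> pr1 -` T1 \<inter> pr2 -` T2"
    then have "pr1 x + pr2 x \<in> \<Omega>1 + \<Omega>2"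
      using pr1_in pr2_in by (intro set_plus_intro) (auto simp: T)
    then show "x \<in> \<Omega>1 + \<Omega>2" by (simp add: pr_sum)
  qed
  moreover have "open (pr1 -` T1)" "open (pr2 -` T2)"
    using T by (auto intro!: open_vimage linear_continuous_on linear_conv_bounded_linear[THEN iffD1] linear_pr1 linear_pr2)
  ultimately show ?thesis by auto
qed

end

section \<open>Blow-up of the energy\<close>

lemma nn_integral_lebesgue_scale:
  fixes f :: "'a::euclidean_space \<Rightarrow> ennreal"
  assumes "f \<in> borel_measurable lebesgue" "0 < h"
  shows "(\<integral>\<^sup>+z. f z \<partial>lebesgue) = (\<integral>\<^sup>+y. ennreal (h ^ DIM('a)) * f (h *\<^sub>R y) \<partial>lebesgue)"
proof -
  have T: "(\<lambda>x::'a. 0 + (\<Sum>j\<in>Basis. (h * (x \<bullet> j)) *\<^sub>R j)) = (\<lambda>x. h *\<^sub>R x)"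
    by (simp add: scaleR_scaleR[symmetric] scaleR_sum_right[symmetric] euclidean_representation
      del: scaleR_scaleR)
  have meas: "(\<lambda>x::'a. h *\<^sub>R x) \<in> lebesgue \<rightarrow>\<^sub>M lebesgue"
    using lebesgue_affine_measurable[of "\<lambda>_::'a. h" 0] assms(2) unfolding T by simp
  have "(lebesgue :: 'a measure) = density (distr lebesgue lebesgue (\<lambda>x. h *\<^sub>R x)) (\<lambda>_. ennreal (h ^ DIM('a)))"
    using lebesgue_affine_euclidean[of "\<lambda>_::'a. h" 0] assms(2) unfolding T by simp
  then have "(\<integral>\<^sup>+z. f z \<partial>lebesgue) =
      (\<integral>\<^sup>+z. f z \<partial>density (distr lebesgue lebesgue (\<lambda>x. h *\<^sub>R x)) (\<lambda>_. ennreal (h ^ DIM('a))))"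
    by simp
  also have "\<dots> = (\<integral>\<^sup>+z. ennreal (h ^ DIM('a)) * f z \<partial>distr lebesgue lebesgue (\<lambda>x. h *\<^sub>R x))"
    using assms(1) by (subst nn_integral_density) auto
  also have "\<dots> = (\<integral>\<^sup>+y. ennreal (h ^ DIM('a)) * f (h *\<^sub>R y) \<partial>lebesgue)"
    using assms(1) meas by (subst nn_integral_distr) auto
  finally show ?thesis .
qed

lemma suminf_finite_imp_tendsto_0:
  fixes f :: "nat \<Rightarrow> ennreal"
  assumes "(\<Sum>k. f k) \<noteq> \<infinity>"
  shows "f \<longlonglongrightarrow> 0"
proof -
  have fin: "f k \<noteq> \<infinity>" for k
    using assms ennreal_suminf_lessD[of f \<infinity> k] by (auto simp: less_top)
  then have eq: "f k = ennreal (enn2real (f k))" for k by (simp add: less_top)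
  have "(\<Sum>k. ennreal (enn2real (f k))) \<noteq> top"
    using assms eq by simp
  then have "summable (\<lambda>k. enn2real (f k))"
    by (intro summable_suminf_not_top) auto
  then have "(\<lambda>k. ennreal (enn2real (f k))) \<longlonglongrightarrow> ennreal 0"
    by (intro tendsto_ennrealI summable_LIMSEQ_zero)
  then show ?thesis using eq by simp
qed

context orthogonal_decomposition
begin

text \<open>The inner integral of the energy, over the measurable set \<open>core \<Omega> (2 * h)\<close>. It bounds the
  integral over the sum of the two shrunken domains from below (\<open>core_subset_shrink\<close>).\<close>

definition core_energy :: "('a \<Rightarrow> real) \<Rightarrow> 'a set \<Rightarrow> real \<Rightarrow> real \<Rightarrow> real \<Rightarrow> real \<Rightarrow> 'a \<Rightarrow> ennreal" where
  "core_energy v \<Omega> p \<theta>1 \<theta>2 h z = (\<integral>\<^sup>+x\<in>core \<Omega> (2 * h).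
      ennreal (\<bar>v (x + pr1 z) - v x\<bar> powr \<theta>1 * \<bar>v (x + pr2 z) - v x\<bar> powr \<theta>2 / norm z powr p) \<partial>lborel)"

lemma core_energy_borel:
  assumes [measurable]: "v \<in> borel_measurable borel"
  shows "core_energy v \<Omega> p \<theta>1 \<theta>2 h \<in> borel_measurable borel"
  unfolding core_energy_def[abs_def] by measurable

lemma core_subset_shrink:
  assumes "\<Omega>1 \<subseteq> X1" "\<Omega>2 \<subseteq> X2" "0 < h"
  shows "core (\<Omega>1 + \<Omega>2) (2 * h) \<subseteq> shrink X1 h \<Omega>1 + shrink X2 h \<Omega>2"
proof
  fix x assume x: "x \<in> core (\<Omega>1 + \<Omega>2) (2 * h)"
  have in\<Omega>: "x + z \<in> \<Omega>1 + \<Omega>2" if "norm z < h" for z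
    using x that assms(3) unfolding core_def by (auto simp: subset_iff dist_norm)
  have pr1_\<Omega>: "pr1 y \<in> \<Omega>1" and pr2_\<Omega>: "pr2 y \<in> \<Omega>2" if "y \<in> \<Omega>1 + \<Omega>2" for y
    using that assms(1,2) pr1_add pr2_add by (auto elim!: set_plus_elim simp: subset_iff)
  have "pr1 x \<in> shrink X1 h \<Omega>1"
    unfolding shrink_def
  proof (rule INT_I)
    fix z assume z: "z \<in> {z \<in> X1. norm z < h}"
    have "pr1 z = z" using pr1_add[of z 0] z sub2 by (simp add: subspace_0)
    then have "pr1 x + z \<in> \<Omega>1" using pr1_\<Omega>[OF in\<Omega>[of z]] z by (simp add: linear_add[OF linear_pr1])
    then show "pr1 x \<in> (\<lambda>x. x - z) ` \<Omega>1" by (intro image_eqI[of _ _ "pr1 x + z"]) auto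
  qed
  moreover have "pr2 x \<in> shrink X2 h \<Omega>2"
    unfolding shrink_def
  proof (rule INT_I)
    fix z assume z: "z \<in> {z \<in> X2. norm z < h}"
    have "pr2 z = z" using pr2_add[of 0 z] z sub1 by (simp add: subspace_0)
    then have "pr2 x + z \<in> \<Omega>2" using pr2_\<Omega>[OF in\<Omega>[of z]] z by (simp add: linear_add[OF linear_pr2])
    then show "pr2 x \<in> (\<lambda>x. x - z) ` \<Omega>2" by (intro image_eqI[of _ _ "pr2 x + z"]) auto
  qed
  ultimately have "pr1 x + pr2 x \<in> shrink X1 h \<Omega>1 + shrink X2 h \<Omega>2" by (rule set_plus_intro)
  then show "x \<in> shrink X1 h \<Omega>1 + shrink X2 h \<Omega>2" by (simp add: pr_sum)
qed

lemma core_energy_le_energy_eps: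
  assumes \<Omega>: "\<Omega>1 \<subseteq> X1" "\<Omega>2 \<subseteq> X2" and h: "0 < h"
    and \<rho>: "\<rho> \<in> borel_measurable lebesgue" "\<And>z. \<rho> z \<noteq> 0 \<Longrightarrow> norm z < 1"
    and v: "v \<in> borel_measurable borel" "\<And>x. x \<in> \<Omega>1 + \<Omega>2 \<Longrightarrow> v x = u x"
  shows "(\<integral>\<^sup>+y. ennreal (\<rho> y) * core_energy v (\<Omega>1 + \<Omega>2) p \<theta>1 \<theta>2 h (h *\<^sub>R y) \<partial>lebesgue)
    \<le> energy_eps X1 X2 \<Omega>1 \<Omega>2 \<rho> p \<theta>1 \<theta>2 h u"
proof -
  let ?\<Omega> = "\<Omega>1 + \<Omega>2"
  let ?K = "core_energy v ?\<Omega> p \<theta>1 \<theta>2 h"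
  have K: "?K \<in> borel_measurable lebesgue"
    using core_energy_borel[OF v(1)] by (intro measurable_completion) simp
  have T: "(\<lambda>x::'a. 0 + (\<Sum>j\<in>Basis. (inverse h * (x \<bullet> j)) *\<^sub>R j)) = (\<lambda>x. x /\<^sub>R h)"
    by (simp add: scaleR_scaleR[symmetric] scaleR_sum_right[symmetric] euclidean_representation
      del: scaleR_scaleR)
  have "(\<lambda>x::'a. x /\<^sub>R h) \<in> lebesgue \<rightarrow>\<^sub>M lebesgue"
    using lebesgue_affine_measurable[of "\<lambda>_::'a. inverse h" 0] h unfolding T by simp
  from measurable_compose[OF this \<rho>(1)]
  have resc: "rescaled \<rho> h \<in> borel_measurable lebesgue"
    unfolding rescaled_def[abs_def] by (intro borel_measurable_divide borel_measurable_const)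
  have "(\<integral>\<^sup>+y. ennreal (\<rho> y) * ?K (h *\<^sub>R y) \<partial>lebesgue) =
      (\<integral>\<^sup>+y. ennreal (h ^ DIM('a)) * (ennreal (rescaled \<rho> h (h *\<^sub>R y)) * ?K (h *\<^sub>R y)) \<partial>lebesgue)"
  proof (intro nn_integral_cong)
    fix y
    have "ennreal (\<rho> y) = ennreal (h ^ DIM('a)) * ennreal (rescaled \<rho> h (h *\<^sub>R y))"
      using h by (subst ennreal_mult'[symmetric]) (simp_all add: rescaled_def)
    then show "ennreal (\<rho> y) * ?K (h *\<^sub>R y) =
       ennreal (h ^ DIM('a)) * (ennreal (rescaled \<rho> h (h *\<^sub>R y)) * ?K (h *\<^sub>R y))"
      by (simp add: mult.assoc)
  qed
  also have "\<dots> = (\<integral>\<^sup>+z. ennreal (rescaled \<rho> h z) * ?K z \<partial>lebesgue)"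
    using resc K h by (intro nn_integral_lebesgue_scale[symmetric]) auto
  also have "\<dots> \<le> energy_eps X1 X2 \<Omega>1 \<Omega>2 \<rho> p \<theta>1 \<theta>2 h u"
    unfolding energy_eps_def
  proof (intro nn_integral_mono)
    fix z :: 'a
    let ?J = "\<integral>\<^sup>+x\<in>shrink X1 h \<Omega>1 + shrink X2 h \<Omega>2. ennreal (\<bar>u (x + pr1 z) - u x\<bar> powr \<theta>1 *
                     \<bar>u (x + pr2 z) - u x\<bar> powr \<theta>2 / norm z powr p) \<partial>lebesgue"
    show "ennreal (rescaled \<rho> h z) * ?K z \<le> ennreal (rescaled \<rho> h z) * ?J"
    proof (cases "\<rho> (z /\<^sub>R h) = 0")
      case True
      then show ?thesis by (simp add: rescaled_def)
    next
      case False
      from \<rho>(2)[OF this] have z: "norm z < h" using h by (simp add: divide_simps)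
      let ?f = "\<lambda>x. ennreal (\<bar>v (x + pr1 z) - v x\<bar> powr \<theta>1 * \<bar>v (x + pr2 z) - v x\<bar> powr \<theta>2 / norm z powr p)
        * indicator (core ?\<Omega> (2 * h)) x"
      have "?f \<in> borel_measurable lborel"
        using v(1) by measurable
      then have "?K z = (\<integral>\<^sup>+x. ?f x \<partial>lebesgue)"
        unfolding core_energy_def by (intro nn_integral_completion[symmetric])
      also have "\<dots> \<le> ?J"
      proof (intro nn_integral_mono)
        fix x
        show "?f x \<le> ennreal (\<bar>u (x + pr1 z) - u x\<bar> powr \<theta>1 * \<bar>u (x + pr2 z) - u x\<bar> powr \<theta>2 / norm z powr p)
          * indicator (shrink X1 h \<Omega>1 + shrink X2 h \<Omega>2) x"
        proof (cases "x \<in> core ?\<Omega> (2 * h)")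
          case True
          have near: "v (x + w) = u (x + w)" if "norm w \<le> norm z" for w
            using True that z h v(2)[of "x + w"] by (auto simp: core_def subset_iff dist_norm)
          have "v (x + pr1 z) = u (x + pr1 z)" "v (x + pr2 z) = u (x + pr2 z)" "v x = u x"
            using near[of "pr1 z"] near[of "pr2 z"] near[of 0] norm_pr1_le[of z] norm_pr2_le[of z] by simp_all
          then show ?thesis
            using True core_subset_shrink[OF \<Omega> h] by (simp add: subset_iff)
        qed simp
      qed
      finally show ?thesis by (intro mult_left_mono) auto
    qed
  qed
  finally show ?thesis .
qed

text \<open>This is the only place where \<open>\<theta>2 \<le> 1\<close> is needed: a bounded quantity is then dominated by its
  \<open>\<theta>2\<close>-th power.\<close>

lemma interaction_le_core_energy:
  assumes "diffq_setting v L \<epsilon> \<theta>1" and \<theta>: "0 < \<theta>2" "\<theta>2 \<le> 1"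
    and y: "y \<noteq> 0" "norm (pr2 y) \<le> 1"
  shows "diffq_setting.interaction v \<Omega> \<epsilon> \<theta>1 (pr1 y) (pr2 y) k
    \<le> ennreal ((L + 1) powr (1 - \<theta>2) * norm y powr (1 + (\<theta>1 + \<theta>2))) *
       core_energy v \<Omega> (1 + (\<theta>1 + \<theta>2)) \<theta>1 \<theta>2 (\<epsilon> k) (\<epsilon> k *\<^sub>R y)"
proof -
  interpret diffq_setting v L \<Omega> \<epsilon> \<theta>1 by fact
  let ?e = "\<epsilon> k" and ?p = "1 + (\<theta>1 + \<theta>2)"
  let ?C = "(L + 1) powr (1 - \<theta>2) * norm y powr ?p"
  let ?g = "\<lambda>x. \<bar>v (x + pr1 (?e *\<^sub>R y)) - v x\<bar> powr \<theta>1 * \<bar>v (x + pr2 (?e *\<^sub>R y)) - v x\<bar> powr \<theta>2 /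
      norm (?e *\<^sub>R y) powr ?p"
  have e: "?e > 0" by (rule \<epsilon>_pos)
  have pt: "\<bar>diffq v ?e (pr1 y) x\<bar> powr \<theta>1 * \<bar>diffq v ?e (pr2 y) x\<bar> / ?e \<le> ?C * ?g x" for x
  proof -
    let ?d1 = "\<bar>diffq v ?e (pr1 y) x\<bar>" and ?d2 = "\<bar>diffq v ?e (pr2 y) x\<bar>"
    have d2: "?d2 \<le> (L + 1) powr (1 - \<theta>2) * ?d2 powr \<theta>2"
    proof (cases "?d2 = 0")
      case False
      then have "?d2 = ?d2 powr (1 - \<theta>2) * ?d2 powr \<theta>2" by (simp add: powr_add[symmetric])
      also have "\<dots> \<le> (L + 1) powr (1 - \<theta>2) * ?d2 powr \<theta>2"
        using diffq_bound[OF e y(2), of x] \<theta> by (intro mult_right_mono powr_mono2) auto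
      finally show ?thesis .
    qed simp
    have 1: "\<bar>v (x + pr1 (?e *\<^sub>R y)) - v x\<bar> = ?e * ?d1" "\<bar>v (x + pr2 (?e *\<^sub>R y)) - v x\<bar> = ?e * ?d2"
      using e by (simp_all add: diffq_def abs_divide linear_scale[OF linear_pr1] linear_scale[OF linear_pr2])
    have "?g x = (?e powr \<theta>1 * ?d1 powr \<theta>1) * (?e powr \<theta>2 * ?d2 powr \<theta>2) / (?e powr ?p * norm y powr ?p)"
      unfolding 1 using e by (simp add: powr_mult)
    moreover have "?e powr ?p = ?e * (?e powr \<theta>1 * ?e powr \<theta>2)"
      using e by (simp add: powr_add)
    ultimately have "?C * ?g x = ?d1 powr \<theta>1 * ((L + 1) powr (1 - \<theta>2) * ?d2 powr \<theta>2) / ?e"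
      using e y(1) by (simp add: field_simps)
    moreover have "?d1 powr \<theta>1 * ?d2 / ?e \<le> ?d1 powr \<theta>1 * ((L + 1) powr (1 - \<theta>2) * ?d2 powr \<theta>2) / ?e"
      using d2 e by (intro divide_right_mono mult_left_mono) auto
    ultimately show ?thesis by simp
  qed
  have meas: "(\<lambda>x. ennreal (?g x) * indicator (core \<Omega> (2 * ?e)) x) \<in> borel_measurable lborel"
    by measurable
  have "interaction (pr1 y) (pr2 y) k \<le>
      (\<integral>\<^sup>+x. ennreal ?C * (ennreal (?g x) * indicator (core \<Omega> (2 * ?e)) x) \<partial>lborel)"
    unfolding interaction_def
  proof (intro nn_integral_mono)
    fix x
    have "ennreal (\<bar>diffq v ?e (pr1 y) x\<bar> powr \<theta>1 * \<bar>diffq v ?e (pr2 y) x\<bar> / ?e) \<le> ennreal ?C * ennreal (?g x)"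
      using ennreal_leI[OF pt[of x]] by (subst (asm) ennreal_mult) auto
    then show "ennreal (\<bar>diffq v ?e (pr1 y) x\<bar> powr \<theta>1 * \<bar>diffq v ?e (pr2 y) x\<bar> / ?e) * indicator (core \<Omega> (2 * ?e)) x
       \<le> ennreal ?C * (ennreal (?g x) * indicator (core \<Omega> (2 * ?e)) x)"
      by (simp add: indicator_def)
  qed
  also have "\<dots> = ennreal ?C * core_energy v \<Omega> ?p \<theta>1 \<theta>2 ?e (?e *\<^sub>R y)"
    unfolding core_energy_def using meas by (intro nn_integral_cmult)
  finally show ?thesis .
qed

text \<open>Along a sequence of scales with energies at most \<open>(1 / 2) ^ k\<close>, the rescaled integrands have an
  integrable sum, so they tend to \<open>0\<close> almost everywhere.\<close>

lemma AE_core_energy_tendsto_0: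
  assumes \<Omega>: "\<Omega>1 \<subseteq> X1" "\<Omega>2 \<subseteq> X2"
    and \<rho>: "\<rho> \<in> borel_measurable lebesgue" "\<And>z. \<rho> z \<noteq> 0 \<Longrightarrow> norm z < 1"
    and v: "v \<in> borel_measurable borel" "\<And>x. x \<in> \<Omega>1 + \<Omega>2 \<Longrightarrow> v x = u x"
    and energy: "energy X1 X2 \<Omega>1 \<Omega>2 \<rho> p \<theta>1 \<theta>2 u = 0"
  obtains \<epsilon> :: "nat \<Rightarrow> real" where "\<And>k. 0 < \<epsilon> k" "\<epsilon> \<longlonglongrightarrow> 0"
    "AE y in lebesgue. 0 < \<rho> y \<longrightarrow> (\<lambda>k. core_energy v (\<Omega>1 + \<Omega>2) p \<theta>1 \<theta>2 (\<epsilon> k) (\<epsilon> k *\<^sub>R y)) \<longlonglongrightarrow> 0"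
proof -
  let ?E = "\<lambda>h. energy_eps X1 X2 \<Omega>1 \<Omega>2 \<rho> p \<theta>1 \<theta>2 h u"
  let ?K = "core_energy v (\<Omega>1 + \<Omega>2) p \<theta>1 \<theta>2"
  have "\<exists>h. 0 < h \<and> h < inverse (Suc k) \<and> ?E h \<le> ennreal ((1 / 2) ^ k)" for k
  proof (rule ccontr)
    assume *: "\<not> ?thesis"
    have "ennreal ((1 / 2) ^ k) \<le> ?E h" if "0 < h" "h < inverse (Suc k)" for h
      using * that by (meson linear)
    then have "\<forall>\<^sub>F h in at_right 0. ennreal ((1 / 2) ^ k) \<le> ?E h"
      unfolding eventually_at_right_field by (intro exI[of _ "inverse (Suc k)"]) auto
    then have "ennreal ((1 / 2) ^ k) \<le> Liminf (at_right 0) ?E"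
      by (rule Liminf_bounded)
    then show False using energy unfolding energy_def by simp
  qed
  then obtain \<epsilon> where \<epsilon>: "\<And>k. 0 < \<epsilon> k" "\<And>k. \<epsilon> k < inverse (Suc k)"
    "\<And>k. ?E (\<epsilon> k) \<le> ennreal ((1 / 2) ^ k)" by metis
  have lim: "\<epsilon> \<longlonglongrightarrow> 0"
  proof (rule tendsto_sandwich[OF _ _ tendsto_const LIMSEQ_inverse_real_of_nat])
    show "\<forall>\<^sub>F k in sequentially. 0 \<le> \<epsilon> k" using \<epsilon>(1) by (simp add: less_imp_le)
    show "\<forall>\<^sub>F k in sequentially. \<epsilon> k \<le> inverse (real (Suc k))"
      using \<epsilon>(2) by (intro always_eventually allI less_imp_le)
  qed
  define f where "f = (\<lambda>k y. ennreal (\<rho> y) * ?K (\<epsilon> k) (\<epsilon> k *\<^sub>R y))"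
  have f: "f k \<in> borel_measurable lebesgue" for k
  proof -
    have "(\<lambda>y. ?K (\<epsilon> k) (\<epsilon> k *\<^sub>R y)) \<in> borel_measurable borel"
      by (rule measurable_compose[OF _ core_energy_borel[OF v(1)]]) measurable
    then have "(\<lambda>y. ?K (\<epsilon> k) (\<epsilon> k *\<^sub>R y)) \<in> borel_measurable lebesgue"
      by (intro measurable_completion) simp
    then show ?thesis unfolding f_def using \<rho>(1) by auto
  qed
  have "(\<integral>\<^sup>+y. (\<Sum>k. f k y) \<partial>lebesgue) = (\<Sum>k. \<integral>\<^sup>+y. f k y \<partial>lebesgue)"
    using f by (rule nn_integral_suminf)
  also have "\<dots> \<le> (\<Sum>k. ennreal ((1 / 2) ^ k))"
  proof (intro suminf_le summableI)
    fix k
    have "(\<integral>\<^sup>+y. f k y \<partial>lebesgue) \<le> ?E (\<epsilon> k)"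
      unfolding f_def using \<Omega> \<epsilon>(1) \<rho> v by (rule core_energy_le_energy_eps)
    also note \<epsilon>(3)[of k]
    finally show "(\<integral>\<^sup>+y. f k y \<partial>lebesgue) \<le> ennreal ((1 / 2) ^ k)" .
  qed
  also have "(\<Sum>k. ennreal ((1 / 2) ^ k)) = ennreal (\<Sum>k. (1 / 2) ^ k)"
    by (intro suminf_ennreal2 summable_geometric) auto
  also have "\<dots> < \<infinity>" by simp
  finally have "AE y in lebesgue. (\<Sum>k. f k y) \<noteq> \<infinity>"
    using f by (intro nn_integral_noteq_infinite borel_measurable_suminf_order) auto
  then have "AE y in lebesgue. 0 < \<rho> y \<longrightarrow> (\<lambda>k. ?K (\<epsilon> k) (\<epsilon> k *\<^sub>R y)) \<longlonglongrightarrow> 0"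
  proof eventually_elim
    case (elim y)
    show ?case
    proof
      assume \<rho>y: "0 < \<rho> y"
      have "(\<lambda>k. f k y) \<longlonglongrightarrow> 0" using elim by (rule suminf_finite_imp_tendsto_0)
      then have "(\<lambda>k. ennreal (1 / \<rho> y) * f k y) \<longlonglongrightarrow> ennreal (1 / \<rho> y) * 0"
        by (intro ennreal_tendsto_cmult) auto
      moreover have "ennreal (1 / \<rho> y) * f k y = ?K (\<epsilon> k) (\<epsilon> k *\<^sub>R y)" for k
        using \<rho>y by (simp add: f_def mult.assoc[symmetric] ennreal_mult[symmetric])
      ultimately show "(\<lambda>k. ?K (\<epsilon> k) (\<epsilon> k *\<^sub>R y)) \<longlonglongrightarrow> 0" by simp
    qed
  qed
  with \<epsilon>(1) lim show ?thesis by (rule that)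
qed

text \<open>Removing a null set together with its images under the reflections leaves a set of directions
  for which all four sign combinations have vanishing interaction.\<close>

lemma good_directions:
  assumes \<Omega>: "\<Omega>1 \<subseteq> X1" "\<Omega>2 \<subseteq> X2"
    and \<rho>: "integrable lebesgue \<rho>" "\<And>z. \<rho> z \<ge> 0" "\<And>y z. norm y = norm z \<Longrightarrow> \<rho> y = \<rho> z"
      "integral\<^sup>L lebesgue \<rho> = 1" "\<And>z. \<rho> z \<noteq> 0 \<Longrightarrow> norm z < 1"
    and \<theta>: "0 < \<theta>1" "0 < \<theta>2" "\<theta>2 \<le> 1"
    and v: "L-lipschitz_on UNIV v" "\<And>x. x \<in> \<Omega>1 + \<Omega>2 \<Longrightarrow> v x = u x"
    and energy: "energy X1 X2 \<Omega>1 \<Omega>2 \<rho> (1 + (\<theta>1 + \<theta>2)) \<theta>1 \<theta>2 u = 0"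
  obtains \<epsilon> D where "D \<in> sets lebesgue" "\<not> negligible D"
    "\<forall>e\<in>X1. \<forall>f\<in>X2. e + f \<in> D \<longrightarrow> good_pair v L (\<Omega>1 + \<Omega>2) \<epsilon> \<theta>1 e f"
proof -
  let ?p = "1 + (\<theta>1 + \<theta>2)"
  have v_borel: "v \<in> borel_measurable borel"
    using v(1) by (intro borel_measurable_continuous_onI lipschitz_on_continuous_on)
  have \<rho>_meas: "\<rho> \<in> borel_measurable lebesgue" using \<rho>(1) by (rule borel_measurable_integrable)
  obtain \<epsilon> where \<epsilon>: "\<And>k. 0 < \<epsilon> k" "\<epsilon> \<longlonglongrightarrow> 0" and
    AE: "AE y in lebesgue. 0 < \<rho> y \<longrightarrow> (\<lambda>k. core_energy v (\<Omega>1 + \<Omega>2) ?p \<theta>1 \<theta>2 (\<epsilon> k) (\<epsilon> k *\<^sub>R y)) \<longlonglongrightarrow> 0"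
    using AE_core_energy_tendsto_0[OF \<Omega> \<rho>_meas \<rho>(5) v_borel v(2) energy] by blast
  obtain N where N: "N \<in> null_sets lebesgue"
    "\<And>y. y \<notin> N \<Longrightarrow> 0 < \<rho> y \<Longrightarrow> (\<lambda>k. core_energy v (\<Omega>1 + \<Omega>2) ?p \<theta>1 \<theta>2 (\<epsilon> k) (\<epsilon> k *\<^sub>R y)) \<longlonglongrightarrow> 0"
    using AE by (auto elim!: AE_E3)
  have negN: "negligible N" using N(1) by (simp add: negligible_iff_null_sets)
  interpret diffq_setting v L "\<Omega>1 + \<Omega>2" \<epsilon> \<theta>1
    using v(1) \<epsilon> \<theta>(1) by unfold_locales
  define R where "R = (\<lambda>s t. {y. reflect s t y \<in> N})"
  define D where "D = {y. 0 < \<rho> y} - ({0} \<union> (R 1 1 \<union> R 1 (-1) \<union> R (-1) 1 \<union> R (-1) (-1)))"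
  have negR: "negligible ({0} \<union> (R 1 1 \<union> R 1 (-1) \<union> R (-1) 1 \<union> R (-1) (-1)))"
    unfolding R_def by (intro negligible_Un negligible_reflect_vimage negN) auto
  have pos: "{y. 0 < \<rho> y} \<in> sets lebesgue"
    using borel_measurable_less[OF borel_measurable_const \<rho>_meas, of 0] by simp
  have D: "D \<in> sets lebesgue"
    unfolding D_def using pos negligible_imp_sets[OF negR] by (rule sets.Diff)
  have "\<not> negligible D"
  proof
    assume "negligible D"
    from negligible_Un[OF this negR]
    have "negligible (D \<union> ({0} \<union> (R 1 1 \<union> R 1 (-1) \<union> R (-1) 1 \<union> R (-1) (-1))))" .
    then have "negligible {y. 0 < \<rho> y}" by (rule negligible_subset) (auto simp: D_def)
    then have "AE y in lebesgue. y \<notin> {y. 0 < \<rho> y}"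
      by (intro AE_not_in) (simp add: negligible_iff_null_sets)
    then have "AE y in lebesgue. \<rho> y = 0"
      by eventually_elim (use \<rho>(2) in \<open>auto simp: not_less intro: antisym\<close>)
    then have "integral\<^sup>L lebesgue \<rho> = 0" by (rule integral_eq_zero_AE)
    with \<rho>(4) show False by simp
  qed
  moreover have "good_pair v L (\<Omega>1 + \<Omega>2) \<epsilon> \<theta>1 e f" if ef: "e \<in> X1" "f \<in> X2" "e + f \<in> D" for e f
  proof -
    let ?y = "e + f"
    have pr: "pr1 ?y = e" "pr2 ?y = f" using ef by (simp_all add: pr1_add pr2_add)
    have \<rho>y: "0 < \<rho> ?y" and y0: "?y \<noteq> 0" using ef(3) by (auto simp: D_def)
    have "norm ?y < 1" using \<rho>(5)[of ?y] \<rho>y by simp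
    then have ne: "norm e \<le> 1" and nf: "norm f \<le> 1"
      using norm_pr1_le[of ?y] norm_pr2_le[of ?y] pr by auto
    have lim: "interaction (s *\<^sub>R e) (t *\<^sub>R f) \<longlonglongrightarrow> 0"
      if st: "s * s = 1" "t * t = 1" "?y \<notin> R s t" for s t
    proof -
      let ?w = "reflect s t ?y"
      have nw: "norm ?w = norm ?y" using st by (intro norm_reflect)
      have w: "?w \<noteq> 0" using nw y0 by (metis norm_eq_zero)
      have "norm ?w < 1" using nw \<open>norm ?y < 1\<close> by simp
      then have w2: "norm (pr2 ?w) \<le> 1" using norm_pr2_le[of ?w] by simp
      have "\<rho> ?w > 0" using \<rho>(3)[OF nw] \<rho>y by simp
      with st N(2) have "(\<lambda>k. core_energy v (\<Omega>1 + \<Omega>2) ?p \<theta>1 \<theta>2 (\<epsilon> k) (\<epsilon> k *\<^sub>R ?w)) \<longlonglongrightarrow> 0"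
        by (auto simp: R_def)
      then have "(\<lambda>k. ennreal ((L + 1) powr (1 - \<theta>2) * norm ?w powr ?p) *
          core_energy v (\<Omega>1 + \<Omega>2) ?p \<theta>1 \<theta>2 (\<epsilon> k) (\<epsilon> k *\<^sub>R ?w)) \<longlonglongrightarrow>
          ennreal ((L + 1) powr (1 - \<theta>2) * norm ?w powr ?p) * 0"
        by (intro ennreal_tendsto_cmult) auto
      note bound_lim = this[unfolded mult_zero_right]
      have "interaction (pr1 ?w) (pr2 ?w) \<longlonglongrightarrow> 0"
        by (rule ennreal_tendsto_0_le[OF always_eventually bound_lim],
            rule allI, rule interaction_le_core_energy[OF diffq_setting_axioms \<theta>(2,3) w w2])
      then show ?thesis by (simp add: pr1_reflect pr2_reflect pr)
    qed
    have "interaction e f \<longlonglongrightarrow> 0" "interaction e (- f) \<longlonglongrightarrow> 0"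
      "interaction (- e) f \<longlonglongrightarrow> 0" "interaction (- e) (- f) \<longlonglongrightarrow> 0"
      using lim[of 1 1] lim[of 1 "-1"] lim[of "-1" 1] lim[of "-1" "-1"] ef(3) by (auto simp: D_def)
    with ne nf show ?thesis
      by (intro good_pair.intro diffq_setting_axioms good_pair_axioms.intro)
  qed
  ultimately show ?thesis by (intro that[OF D]) blast+
qed

end

section \<open>Vanishing energy forces one-sided dependence\<close>

lemma energy_swap:
  "energy X2 X1 \<Omega>2 \<Omega>1 \<rho> p \<theta>2 \<theta>1 u = energy X1 X2 \<Omega>1 \<Omega>2 \<rho> p \<theta>1 \<theta>2 u"
  unfolding energy_def energy_eps_def
  by (simp only: mult.commute add.commute[of "shrink X2 _ \<Omega>2" "shrink X1 _ \<Omega>1"])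

lemma (in orthogonal_decomposition) zero_energy_dichotomy:
  assumes \<Omega>1: "openin (top_of_set X1) \<Omega>1" "connected \<Omega>1" "\<Omega>1 \<noteq> {}"
    and \<Omega>2: "openin (top_of_set X2) \<Omega>2" "connected \<Omega>2" "\<Omega>2 \<noteq> {}"
    and \<rho>: "integrable lebesgue \<rho>" "\<And>z. \<rho> z \<ge> 0" "\<And>y z. norm y = norm z \<Longrightarrow> \<rho> y = \<rho> z"
      "integral\<^sup>L lebesgue \<rho> = 1" "\<And>z. \<rho> z \<noteq> 0 \<Longrightarrow> norm z < 1"
    and \<theta>: "0 < \<theta>1" "0 < \<theta>2" "\<theta>2 \<le> 1"
    and u: "L-lipschitz_on (\<Omega>1 + \<Omega>2) u"
    and energy: "energy X1 X2 \<Omega>1 \<Omega>2 \<rho> (1 + (\<theta>1 + \<theta>2)) \<theta>1 \<theta>2 u = 0"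
  shows "(\<forall>x\<in>\<Omega>1. \<forall>y\<in>\<Omega>2. \<forall>y'\<in>\<Omega>2. u (x + y) = u (x + y')) \<or>
         (\<forall>y\<in>\<Omega>2. \<forall>x\<in>\<Omega>1. \<forall>x'\<in>\<Omega>1. u (x + y) = u (x' + y))"
proof -
  have sub: "\<Omega>1 \<subseteq> X1" "\<Omega>2 \<subseteq> X2" using \<Omega>1(1) \<Omega>2(1) by (auto dest: openin_imp_subset)
  have "\<Omega>1 + \<Omega>2 \<noteq> {}" using \<Omega>1(3) \<Omega>2(3) by (auto simp: set_plus_def)
  from lipschitz_extension[OF u this] obtain v where
    v: "L-lipschitz_on UNIV v" "\<And>x. x \<in> \<Omega>1 + \<Omega>2 \<Longrightarrow> v x = u x" by blast
  have opn: "open (\<Omega>1 + \<Omega>2)" using \<Omega>1(1) \<Omega>2(1) by (rule open_sum)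
  obtain \<epsilon> D where D: "D \<in> sets lebesgue" "\<not> negligible D"
    "\<forall>e\<in>X1. \<forall>f\<in>X2. e + f \<in> D \<longrightarrow> good_pair v L (\<Omega>1 + \<Omega>2) \<epsilon> \<theta>1 e f"
    by (rule good_directions[OF sub \<rho> \<theta> v energy]; (assumption | rule that; assumption))
  let ?F = "\<lambda>e. {f \<in> X2. e + f \<in> D}"
  let ?E = "{e \<in> X1. span (?F e) = X2}"
  have "(\<forall>x\<in>\<Omega>1. \<forall>y\<in>\<Omega>2. \<forall>y'\<in>\<Omega>2. v (x + y) = v (x + y')) \<or>
        (\<forall>y\<in>\<Omega>2. \<forall>x\<in>\<Omega>1. \<forall>x'\<in>\<Omega>1. v (x + y) = v (x' + y))"
  proof (rule one_sided_dependence[OF opn _ _ \<Omega>1(2) \<Omega>2(2), where E="?E"])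
    show "continuous_on UNIV v" using v(1) by (rule lipschitz_on_continuous_on)
    show "\<Omega>1 \<subseteq> span ?E" using spanning_directions[OF D(1,2)] sub(1) by simp
    fix e assume e: "e \<in> ?E"
    have "loc_const_dir (rigidity_state v e) f x" if "f \<in> ?F e" "x \<in> \<Omega>1 + \<Omega>2" for f x
    proof -
      have "good_pair v L (\<Omega>1 + \<Omega>2) \<epsilon> \<theta>1 e f" using D(3) e that(1) by blast
      from good_pair.rigidity_state_loc_const[OF this opn that(2)] show ?thesis .
    qed
    then show "\<exists>F. \<Omega>2 \<subseteq> span F \<and>
        (\<forall>f\<in>F. \<forall>x\<in>\<Omega>1 + \<Omega>2. loc_const_dir (rigidity_state v e) f x)"
      using e sub(2) by (intro exI[of _ "?F e"]) auto
  qed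
  then show ?thesis using v(2) by (simp add: set_plus_intro)
qed

lemma continuous_imp_measurable_fun_on:
  assumes "continuous_on UNIV f"
  shows "f \<in> measurable_fun_on X U"
proof -
  have "f \<in> borel_measurable borel"
    using assms by (rule borel_measurable_continuous_onI)
  then have "f \<in> borel_measurable (subspace_lebesgue X)"
    unfolding subspace_lebesgue_def Let_def by (intro measurable_completion) simp
  then show ?thesis
    unfolding measurable_fun_on_def by (rule measurable_restrict_space1)
qed

lemma (in orthogonal_decomposition) depends_on_pr1_imp_representation:
  assumes sub: "\<Omega>1 \<subseteq> X1" "\<Omega>2 \<subseteq> X2" "\<Omega>2 \<noteq> {}"
    and u: "L-lipschitz_on (\<Omega>1 + \<Omega>2) u" "\<Omega>1 + \<Omega>2 \<noteq> {}"
    and dep: "\<forall>x\<in>\<Omega>1. \<forall>y\<in>\<Omega>2. \<forall>y'\<in>\<Omega>2. u (x + y) = u (x + y')"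
  shows "\<exists>u1\<in>measurable_fun_on X1 \<Omega>1. \<forall>x\<in>\<Omega>1 + \<Omega>2. u x = u1 (pr1 x)"
proof -
  obtain v where v: "L-lipschitz_on UNIV v" "\<And>x. x \<in> \<Omega>1 + \<Omega>2 \<Longrightarrow> v x = u x"
    using lipschitz_extension[OF u] by blast
  have v_cont: "continuous_on UNIV v" using v(1) by (rule lipschitz_on_continuous_on)
  obtain y0 where y0: "y0 \<in> \<Omega>2" using sub(3) by blast
  have "(\<lambda>x. v (x + y0)) \<in> measurable_fun_on X1 \<Omega>1"
    by (intro continuous_imp_measurable_fun_on continuous_on_compose2[OF v_cont] continuous_intros) auto
  moreover have "u x = v (pr1 x + y0)" if "x \<in> \<Omega>1 + \<Omega>2" for x
    using that
  proof (rule set_plus_elim)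
    fix a b assume ab: "x = a + b" "a \<in> \<Omega>1" "b \<in> \<Omega>2"
    then have "pr1 x = a" using sub by (auto intro: pr1_add)
    moreover have "v (a + y0) = u (a + y0)" using ab y0 by (intro v(2) set_plus_intro)
    ultimately show ?thesis using dep ab y0 by metis
  qed
  ultimately show ?thesis by (intro bexI[of _ "\<lambda>x. v (x + y0)"]) auto
qed

theorem proposition5:
  fixes X1 X2 \<Omega>1 \<Omega>2 :: "'a::euclidean_space set"
    and \<rho> u :: "'a \<Rightarrow> real"
    and \<theta>1 \<theta>2 \<theta> :: real
  assumes "subspace X1" and "subspace X2"
    and "dim X1 \<ge> 1" and "dim X2 \<ge> 1"
    and "\<forall>x\<in>X1. \<forall>y\<in>X2. orthogonal x y"
    and "X1 + X2 = UNIV"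
    and "\<Omega>1 \<noteq> {}" and "openin (top_of_set X1) \<Omega>1" and "connected \<Omega>1" and "bounded \<Omega>1"
    and "\<Omega>2 \<noteq> {}" and "openin (top_of_set X2) \<Omega>2" and "connected \<Omega>2" and "bounded \<Omega>2"
    and "integrable lebesgue \<rho>" and "\<forall>z. \<rho> z \<ge> 0"
    and "\<forall>y z. norm y = norm z \<longrightarrow> \<rho> y = \<rho> z"
    and "integral\<^sup>L lebesgue \<rho> = 1"
    and "closure {z. \<rho> z \<noteq> 0} \<subseteq> ball 0 1"
    and "\<theta>1 > 0" and "\<theta>2 > 0" and "min \<theta>1 \<theta>2 \<le> 1" and "\<theta> = \<theta>1 + \<theta>2"
    and "\<exists>L. L-lipschitz_on (\<Omega>1 + \<Omega>2) u"
    and "energy X1 X2 \<Omega>1 \<Omega>2 \<rho> (1 + \<theta>) \<theta>1 \<theta>2 u = 0"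
  shows "u \<in> S_class X1 X2 \<Omega>1 \<Omega>2"
proof -
  interpret od: orthogonal_decomposition X1 X2
    by unfold_locales (use assms(1,2,5,6) in auto)
  note swap = od.swap
  have sub: "\<Omega>1 \<subseteq> X1" "\<Omega>2 \<subseteq> X2"
    using assms(8,12) by (auto dest: openin_imp_subset)
  obtain L where L: "L-lipschitz_on (\<Omega>1 + \<Omega>2) u" using assms(24) by blast
  have ne: "\<Omega>1 + \<Omega>2 \<noteq> {}" using assms(7,11) by (auto simp: set_plus_def)
  have \<rho>: "\<rho> z \<ge> 0" "norm y = norm z \<Longrightarrow> \<rho> y = \<rho> z" "\<rho> z \<noteq> 0 \<Longrightarrow> norm z < 1" for y z
  proof -
    show "\<rho> z \<ge> 0" using assms(16) by blast
    show "norm y = norm z \<Longrightarrow> \<rho> y = \<rho> z" using assms(17) by blast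
    assume "\<rho> z \<noteq> 0"
    then have "z \<in> closure {z. \<rho> z \<noteq> 0}" by (intro closure_subset[THEN subsetD]) simp
    with assms(19) show "norm z < 1" by auto
  qed
  have dichotomy: "(\<forall>x\<in>\<Omega>1. \<forall>y\<in>\<Omega>2. \<forall>y'\<in>\<Omega>2. u (x + y) = u (x + y')) \<or>
         (\<forall>y\<in>\<Omega>2. \<forall>x\<in>\<Omega>1. \<forall>x'\<in>\<Omega>1. u (x + y) = u (x' + y))"
  proof (cases "\<theta>2 \<le> 1")
    case True
    have "energy X1 X2 \<Omega>1 \<Omega>2 \<rho> (1 + (\<theta>1 + \<theta>2)) \<theta>1 \<theta>2 u = 0"
      using assms(25) unfolding assms(23) .
    then show ?thesis
      by (intro od.zero_energy_dichotomy[OF assms(8,9,7,12,13,11,15) \<rho>(1,2) assms(18) \<rho>(3) assms(20,21) True L])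
  next
    case False
    with assms(22) have \<theta>1: "\<theta>1 \<le> 1" by auto
    have "energy X2 X1 \<Omega>2 \<Omega>1 \<rho> (1 + (\<theta>2 + \<theta>1)) \<theta>2 \<theta>1 u = 0"
      using assms(25) unfolding assms(23) energy_swap[of X2] add.commute[of \<theta>2] .
    moreover have "L-lipschitz_on (\<Omega>2 + \<Omega>1) u" using L by (simp add: add.commute)
    ultimately have "(\<forall>x\<in>\<Omega>2. \<forall>y\<in>\<Omega>1. \<forall>y'\<in>\<Omega>1. u (x + y) = u (x + y')) \<or>
         (\<forall>y\<in>\<Omega>1. \<forall>x\<in>\<Omega>2. \<forall>x'\<in>\<Omega>2. u (x + y) = u (x' + y))"
      by (intro orthogonal_decomposition.zero_energy_dichotomy[OF swap assms(12,13,11,8,9,7,15) \<rho>(1,2) assms(18) \<rho>(3) assms(21,20) \<theta>1])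
    then show ?thesis by (simp only: add.commute) blast
  qed
  obtain v where v: "L-lipschitz_on UNIV v" "\<And>x. x \<in> \<Omega>1 + \<Omega>2 \<Longrightarrow> v x = u x"
    using lipschitz_extension[OF L ne] by blast
  have "v \<in> borel_measurable borel"
    using v(1) by (intro borel_measurable_continuous_onI lipschitz_on_continuous_on)
  then have "v \<in> borel_measurable (lebesgue_on (\<Omega>1 + \<Omega>2))"
    by (intro measurable_restrict_space1 measurable_completion) simp
  then have "u \<in> borel_measurable (lebesgue_on (\<Omega>1 + \<Omega>2))"
    by (rule measurable_cong[THEN iffD1, rotated]) (simp add: v(2) space_restrict_space)
  moreover have everywhere: "AE x in lebesgue_on (\<Omega>1 + \<Omega>2). P x" if "\<forall>x\<in>\<Omega>1 + \<Omega>2. P x" for P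
    using that by (intro AE_I2) (simp add: space_restrict_space)
  moreover have "(\<exists>u1\<in>measurable_fun_on X1 \<Omega>1. \<forall>x\<in>\<Omega>1 + \<Omega>2. u x = u1 (component X1 X2 x)) \<or>
      (\<exists>u2\<in>measurable_fun_on X2 \<Omega>2. \<forall>x\<in>\<Omega>1 + \<Omega>2. u x = u2 (component X2 X1 x))"
    using dichotomy
  proof (rule disj_forward)
    assume "\<forall>x\<in>\<Omega>1. \<forall>y\<in>\<Omega>2. \<forall>y'\<in>\<Omega>2. u (x + y) = u (x + y')"
    then show "\<exists>u1\<in>measurable_fun_on X1 \<Omega>1. \<forall>x\<in>\<Omega>1 + \<Omega>2. u x = u1 (component X1 X2 x)"
      by (rule od.depends_on_pr1_imp_representation[OF sub assms(11) L ne])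
  next
    assume "\<forall>y\<in>\<Omega>2. \<forall>x\<in>\<Omega>1. \<forall>x'\<in>\<Omega>1. u (x + y) = u (x' + y)"
    then have "\<forall>y\<in>\<Omega>2. \<forall>x\<in>\<Omega>1. \<forall>x'\<in>\<Omega>1. u (y + x) = u (y + x')" by (simp only: add.commute)
    with L ne show "\<exists>u2\<in>measurable_fun_on X2 \<Omega>2. \<forall>x\<in>\<Omega>1 + \<Omega>2. u x = u2 (component X2 X1 x)"
      unfolding add.commute[of \<Omega>1 \<Omega>2]
      by (rule orthogonal_decomposition.depends_on_pr1_imp_representation[OF swap sub(2,1) assms(7)])
  qed
  ultimately show ?thesis
    unfolding S_class_def by blast
qed

end
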